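(* Let $(X_i,Y_i,\mathbf{Z}_i)$, $i=1,\dots,n$, be i.i.d. observations from the Gaussian additive noise model, let $n_1=n_2=n/2$, and let $\hat m_{x1},\hat m_{y1}$ (computed from the first $n_1$ observations) and $\hat m_{x2},\hat m_{y2}$ (computed from the last $n_2$ observations) be estimators of $m_x,m_y$ satisfying $$\|\hat m_{xk}-m_x\|_2=o_p(n_1^{-1/4}),\qquad \|\hat m_{yk}-m_y\|_2=o_p(n_1^{-1/4}),\qquad k=1,2.$$ Let $\hat\rho=(\hat\rho_1+\hat\rho_2)/2$ be the cross-fitted residual correlation estimator. Then, as $n\to\infty$, $$n^{1/2}(\hat\rho-\rho)\xrightarrow{d}N\left\{0,(1-\rho^2)^2\right\}.$$
   Context: Gaussian additive noise model (GANM): $X,Y$ are real random variables, $\mathbf{Z}$ is a random vector with distribution $P_{\mathbf{Z}}$ (having density $f_{\mathbf{Z}}$), $X=m_x(\mathbf{Z})+\epsilon_x$, $Y=m_y(\mathbf{Z})+\epsilon_y$, where $(\epsilon_x,\epsilon_y)$ is independent of $\mathbf{Z}$ and bivariate normal with mean zero, variances $\sigma_x^2,\sigma_y^2>0$ and correlation $\rho\in(-1,1)$. $\|g\|_2=\{\int g(\mathbf{z})^2\,dP_{\mathbf{Z}}(\mathbf{z})\}^{1/2}$ is the $L_2(P_{\mathbf{Z}})$-norm; for a random (estimated) function, the integral is over $\mathbf{z}$ only, with the estimated function held fixed. Cross-fitting. With $\hat m_{x1},\hat m_{y1}$ computed from observations $1,\dots,n_1$, put $\hat\epsilon_{xi1}=X_i-\hat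 m_{x1}(\mathbf{Z}_i)$, $\hat\epsilon_{yi1}=Y_i-\hat m_{y1}(\mathbf{Z}_i)$ for $i=n_1+1,\dots,n$, and $$\hat\rho_2=\frac{\sum_{i=n_1+1}^n\hat\epsilon_{xi1}\hat\epsilon_{yi1}}{\left(\sum_{i=n_1+1}^n\hat\epsilon_{xi1}^2\right)^{1/2}\left(\sum_{i=n_1+1}^n\hat\epsilon_{yi1}^2\right)^{1/2}}.$$ With $\hat m_{x2},\hat m_{y2}$ computed from observations $n_1+1,\dots,n$, put $\hat\epsilon_{xi2}=X_i-\hat m_{x2}(\mathbf{Z}_i)$, $\hat\epsilon_{yi2}=Y_i-\hat m_{y2}(\mathbf{Z}_i)$ for $i=1,\dots,n_1$, and $$\hat\rho_1=\frac{\sum_{i=1}^{n_1}\hat\epsilon_{xi2}\hat\epsilon_{yi2}}{\left(\sum_{i=1}^{n_1}\hat\epsilon_{xi2}^2\right)^{1/2}\left(\sum_{i=1}^{n_1}\hat\epsilon_{yi2}^2\right)^{1/2}}.$$ *)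

theory Defs
  imports "HOL-Probability.Probability"
begin

definition bivariate_normal_density :: "real \<Rightarrow> real \<Rightarrow> real \<Rightarrow> real \<times> real \<Rightarrow> real" where
  "bivariate_normal_density \<sigma>x \<sigma>y \<rho> = (\<lambda>(u, v).
     1 / (2 * pi * \<sigma>x * \<sigma>y * sqrt (1 - \<rho>\<^sup>2)) *
     exp (- ((u / \<sigma>x)\<^sup>2 - 2 * \<rho> * (u / \<sigma>x) * (v / \<sigma>y) + (v / \<sigma>y)\<^sup>2) / (2 * (1 - \<rho>\<^sup>2))))"

text \<open>
  Independence of two random variables, as \<open>prob_space.indep_var\<close>, but with possibly
  different value types.
\<close>

definition independent_rv ::
  "'a measure \<Rightarrow> 'b measure \<Rightarrow> ('a \<Rightarrow> 'b) \<Rightarrow> 'c measure \<Rightarrow> ('a \<Rightarrow> 'c) \<Rightarrow> bool" where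
  "independent_rv M S U T V \<longleftrightarrow>
     U \<in> measurable M S \<and> V \<in> measurable M T \<and>
     prob_space.indep_set M {U -` A \<inter> space M | A. A \<in> sets S} {V -` B \<inter> space M | B. B \<in> sets T}"

text \<open>
  The Gaussian additive noise model. The errors are centred with standard deviations
  \<open>\<sigma>x\<close>, \<open>\<sigma>y\<close> and correlation \<open>\<rho>\<close>. The regression functions are only assumed to be Borel
  measurable.
\<close>

definition GANM ::
  "'a measure \<Rightarrow> ('a \<Rightarrow> real) \<Rightarrow> ('a \<Rightarrow> real) \<Rightarrow> ('a \<Rightarrow> 'z :: euclidean_space) \<Rightarrow> ('z \<Rightarrow> ennreal) \<Rightarrow>
   ('z \<Rightarrow> real) \<Rightarrow> ('z \<Rightarrow> real) \<Rightarrow> real \<Rightarrow> real \<Rightarrow> real \<Rightarrow> bool" where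
  "GANM M X Y Z f mx my \<sigma>x \<sigma>y \<rho> \<longleftrightarrow>
     mx \<in> borel_measurable borel \<and> my \<in> borel_measurable borel \<and>
     0 < \<sigma>x \<and> 0 < \<sigma>y \<and> -1 < \<rho> \<and> \<rho> < 1 \<and>
     distributed M lborel Z f \<and>
     (\<exists>\<epsilon>x \<epsilon>y.
        distributed M lborel (\<lambda>\<omega>. (\<epsilon>x \<omega>, \<epsilon>y \<omega>))
          (\<lambda>e. ennreal (bivariate_normal_density \<sigma>x \<sigma>y \<rho> e)) \<and>
        independent_rv M borel (\<lambda>\<omega>. (\<epsilon>x \<omega>, \<epsilon>y \<omega>)) borel Z \<and>
        (\<forall>\<omega>\<in>space M. X \<omega> = mx (Z \<omega>) + \<epsilon>x \<omega> \<and> Y \<omega> = my (Z \<omega>) + \<epsilon>y \<omega>))"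

definition iid :: "'a measure \<Rightarrow> 'b measure \<Rightarrow> nat set \<Rightarrow> (nat \<Rightarrow> 'a \<Rightarrow> 'b) \<Rightarrow> bool" where
  "iid M N I W \<longleftrightarrow> prob_space.indep_vars M (\<lambda>_. N) W I \<and>
     (\<forall>i\<in>I. \<forall>j\<in>I. distr M N (W i) = distr M N (W j))"

text \<open>
  The \<open>L\<^sub>2(P)\<close> norm with value \<open>\<infinity>\<close> for functions that are not square integrable; the Bochner
  integral would give them norm 0.
\<close>

definition L2_norm :: "'z measure \<Rightarrow> ('z \<Rightarrow> real) \<Rightarrow> ennreal" where
  "L2_norm P g =
     (let I = \<integral>\<^sup>+ z. ennreal ((g z)\<^sup>2) \<partial>P in if I = \<infinity> then \<infinity> else ennreal (sqrt (enn2real I)))"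

text \<open>
  Intended for measurable \<open>V n\<close> only, since \<open>measure\<close> is 0 on nonmeasurable sets. For
  \<open>L2_norm\<close> of an estimation error, measurability follows from the joint measurability
  required of estimators below.
\<close>

definition small_o_p :: "'a measure \<Rightarrow> (nat \<Rightarrow> 'a \<Rightarrow> ennreal) \<Rightarrow> (nat \<Rightarrow> real) \<Rightarrow> bool" where
  "small_o_p M V a \<longleftrightarrow>
     (\<forall>e>0. (\<lambda>n. measure M {\<omega>\<in>space M. V n \<omega> > ennreal (e * a n)}) \<longlonglongrightarrow> 0)"

text \<open>
  An estimator of a regression function computed from the observations with index in \<open>I\<close> maps
  these observations to a function of \<open>z\<close>, jointly measurably.
\<close>

definition regression_estimator ::
  "nat set \<Rightarrow> ((nat \<Rightarrow> real \<times> real \<times> ('z :: euclidean_space)) \<Rightarrow> 'z \<Rightarrow> real) \<Rightarrow> bool" where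
  "regression_estimator I T \<longleftrightarrow>
     (\<lambda>(d, z). T d z) \<in> borel_measurable ((\<Pi>\<^sub>M i\<in>I. borel) \<Otimes>\<^sub>M borel)"

definition fitted ::
  "(nat \<Rightarrow> 'a \<Rightarrow> 'w) \<Rightarrow> nat set \<Rightarrow> ((nat \<Rightarrow> 'w) \<Rightarrow> 'z \<Rightarrow> real) \<Rightarrow> 'a \<Rightarrow> 'z \<Rightarrow> real" where
  "fitted W I T \<omega> = T (\<lambda>i\<in>I. W i \<omega>)"

definition residual_corr :: "nat set \<Rightarrow> (nat \<Rightarrow> real) \<Rightarrow> (nat \<Rightarrow> real) \<Rightarrow> real" where
  "residual_corr I u v =
     (\<Sum>i\<in>I. u i * v i) / (sqrt (\<Sum>i\<in>I. (u i)\<^sup>2) * sqrt (\<Sum>i\<in>I. (v i)\<^sup>2))"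

text \<open>
  Arguments \<open>gx1\<close>, \<open>gy1\<close> are the random functions fitted on observations \<open>1, \<dots>, n1\<close> and
  \<open>gx2\<close>, \<open>gy2\<close> those fitted on observations \<open>n1 + 1, \<dots>, n\<close>; residuals are taken on the
  opposite half.
\<close>

definition cross_fit_corr ::
  "(nat \<Rightarrow> 'a \<Rightarrow> real) \<Rightarrow> (nat \<Rightarrow> 'a \<Rightarrow> real) \<Rightarrow> (nat \<Rightarrow> 'a \<Rightarrow> 'z) \<Rightarrow> nat \<Rightarrow> nat \<Rightarrow>
   ('a \<Rightarrow> 'z \<Rightarrow> real) \<Rightarrow> ('a \<Rightarrow> 'z \<Rightarrow> real) \<Rightarrow> ('a \<Rightarrow> 'z \<Rightarrow> real) \<Rightarrow> ('a \<Rightarrow> 'z \<Rightarrow> real) \<Rightarrow> 'a \<Rightarrow> real" where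
  "cross_fit_corr X Y Z n1 n gx1 gy1 gx2 gy2 \<omega> =
     (residual_corr {1..n1}
        (\<lambda>i. X i \<omega> - gx2 \<omega> (Z i \<omega>)) (\<lambda>i. Y i \<omega> - gy2 \<omega> (Z i \<omega>)) +
      residual_corr {n1 + 1..n}
        (\<lambda>i. X i \<omega> - gx1 \<omega> (Z i \<omega>)) (\<lambda>i. Y i \<omega> - gy1 \<omega> (Z i \<omega>))) / 2"

end

theory Submission
  imports Defs
begin

text \<open>
  Dividing the residuals by \<open>\<sigma>x\<close> and \<open>\<sigma>y\<close> does not change their correlation. On one half of
  the sample they then read \<open>\<xi>\<^sub>i + a\<^sub>i\<close> and \<open>\<eta>\<^sub>i + b\<^sub>i\<close>, where \<open>\<xi>, \<eta>\<close> are the standardised errors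
  and \<open>a\<^sub>i, b\<^sub>i\<close> are the scaled estimation errors, at \<open>Z\<^sub>i\<close>, of the regressions fitted on the
  other half. Let \<open>A, B, C\<close> be the averages over the \<open>n\<close> observations of that half of the two
  squared residuals and of their product.

  The estimation errors have no effect to first order. Given the data of the other half, \<open>a\<close> is a
  fixed function of \<open>Z\<close>. The sum of \<open>a\<^sub>i\<^sup>2\<close>, divided by \<open>sqrt n\<close>, has conditional mean
  \<open>sqrt n * \<parallel>a\<parallel>\<^sup>2\<close>, which the rate \<open>n\<close> to the power \<open>-1/4\<close> makes vanish. The products \<open>\<xi>\<^sub>i a\<^sub>i\<close> are
  conditionally independent and centred, because errors are independent of \<open>Z\<close>; hence their sum
  divided by \<open>sqrt n\<close> has conditional second moment \<open>\<parallel>a\<parallel>\<^sup>2\<close>, which vanishes too. These are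
  \<open>square_term_vanishes\<close> and \<open>error_term_vanishes\<close>; the passage from conditional moments to
  convergence in probability is \<open>conditional_Markov_in_prob\<close>.

  The correlation \<open>C / sqrt (A * B)\<close> equals \<open>\<rho> + (C - \<rho> * (A + B) / 2)\<close> up to a remainder that is
  quadratic in the deviations of \<open>A, B, C\<close> from \<open>1, 1, \<rho>\<close> (\<open>correlation_linearisation\<close>). The
  deviations are of smaller order than \<open>n\<close> to the power \<open>-1/4\<close>, so the remainder survives no
  multiplication by \<open>sqrt n\<close>. Consequently the correlation of each half is \<open>\<rho>\<close> plus the average
  over that half of \<open>\<psi> = \<xi> * \<eta> - \<rho> * (\<xi>\<^sup>2 + \<eta>\<^sup>2) / 2\<close>, up to an error of smaller order than
  \<open>1 / sqrt n\<close> (\<open>residual_expansion\<close>). The mean of the two halves is \<open>\<rho>\<close> plus the average of \<open>\<psi>\<close>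
  over the whole sample, and the central limit theorem together with Slutsky's lemma applies.

  The variance comes from writing \<open>\<eta> = \<rho> * \<xi> + \<tau> * \<zeta>\<close> with \<open>\<tau> = sqrt (1 - \<rho>\<^sup>2)\<close> and \<open>\<xi>, \<zeta>\<close>
  independent standard normal. Then \<open>\<psi> = \<rho> * \<tau>\<^sup>2 / 2 * (\<xi>\<^sup>2 - \<zeta>\<^sup>2) + \<tau>\<^sup>3 * \<xi> * \<zeta>\<close> is a sum of two
  uncorrelated terms, of total variance \<open>\<rho>\<^sup>2 * \<tau>\<^sup>4 + \<tau>\<^sup>6 = \<tau>\<^sup>4 = (1 - \<rho>\<^sup>2)\<^sup>2\<close>.

  Convergence in probability is rendered as convergence along a filter, \<open>in_prob\<close>, so that the
  usual calculus of limits applies to random sequences.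
\<close>

section \<open>Convergence in probability\<close>

text \<open>
  A property holds eventually along this filter if for every \<open>r > 0\<close> and all large \<open>n\<close> it holds
  outside an event of probability at most \<open>r\<close>. Random variables \<open>V n\<close> converge to \<open>c\<close> in
  probability when \<open>\<lambda>(n, \<omega>). V n \<omega>\<close> tends to \<open>c\<close> along it. The exceptional set is only required to
  lie inside a small event, so that limits can be combined without measurability side conditions.
\<close>

definition in_prob :: "'a measure \<Rightarrow> (nat \<times> 'a) filter" where
  "in_prob M = Abs_filter (\<lambda>P. \<forall>r>0. \<forall>\<^sub>F n in sequentially.
     \<exists>A\<in>sets M. emeasure M A \<le> ennreal r \<and> (\<forall>\<omega>\<in>space M - A. P (n, \<omega>)))"

lemma eventually_in_prob:
  "eventually P (in_prob M) \<longleftrightarrow> (\<forall>r>0. \<forall>\<^sub>F n in sequentially.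
     \<exists>A\<in>sets M. emeasure M A \<le> ennreal r \<and> (\<forall>\<omega>\<in>space M - A. P (n, \<omega>)))"
  unfolding in_prob_def
proof (rule eventually_Abs_filter, rule is_filter.intro, goal_cases)
  case 1
  show ?case by (auto intro!: always_eventually bexI[of _ "{}"])
next
  case (2 P Q)
  show ?case
  proof (intro allI impI)
    fix r :: real assume "0 < r"
    then have "0 < r / 2" by simp
    show "\<forall>\<^sub>F n in sequentially. \<exists>A\<in>sets M. emeasure M A \<le> ennreal r \<and>
        (\<forall>\<omega>\<in>space M - A. P (n, \<omega>) \<and> Q (n, \<omega>))"
      using 2(1)[rule_format, OF \<open>0 < r / 2\<close>] 2(2)[rule_format, OF \<open>0 < r / 2\<close>]
    proof eventually_elim
      case (elim n)
      then obtain A B where AB: "A \<in> sets M" "B \<in> sets M"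
        "emeasure M A \<le> ennreal (r / 2)" "emeasure M B \<le> ennreal (r / 2)"
        "\<forall>\<omega>\<in>space M - A. P (n, \<omega>)" "\<forall>\<omega>\<in>space M - B. Q (n, \<omega>)" by auto
      have "emeasure M (A \<union> B) \<le> emeasure M A + emeasure M B"
        using AB by (intro emeasure_subadditive)
      also have "\<dots> \<le> ennreal (r / 2) + ennreal (r / 2)"
        using AB by (intro add_mono)
      also have "\<dots> = ennreal r"
        using \<open>0 < r\<close> by (simp flip: ennreal_plus)
      finally show ?case
        using AB by (intro bexI[of _ "A \<union> B"]) auto
    qed
  qed
next
  case (3 P Q)
  show ?case
  proof (intro allI impI)
    fix r :: real assume "0 < r"
    show "\<forall>\<^sub>F n in sequentially. \<exists>A\<in>sets M. emeasure M A \<le> ennreal r \<and>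
        (\<forall>\<omega>\<in>space M - A. Q (n, \<omega>))"
      using 3(2)[rule_format, OF \<open>0 < r\<close>] by eventually_elim (use 3(1) in blast)
  qed
qed

lemma filterlim_fst_in_prob: "filterlim fst sequentially (in_prob M)"
  unfolding filterlim_iff eventually_in_prob
  by (auto elim!: eventually_mono intro!: bexI[of _ "{}"])

lemma eventually_in_prob_everywhere:
  assumes "\<forall>\<^sub>F n in sequentially. \<forall>\<omega>\<in>space M. P (n, \<omega>)"
  shows "eventually P (in_prob M)"
  unfolding eventually_in_prob
  using assms by (auto elim!: eventually_mono intro!: bexI[of _ "{}"])

lemma Markov_ennreal:
  assumes [measurable]: "g \<in> borel_measurable M"
    and e: "e \<noteq> 0" "e \<noteq> \<top>" and int: "(\<integral>\<^sup>+\<omega>. g \<omega> \<partial>M) \<le> e * r"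
  shows "emeasure M {\<omega>\<in>space M. e \<le> g \<omega>} \<le> r"
proof -
  have "e * emeasure M {\<omega>\<in>space M. e \<le> g \<omega>} = (\<integral>\<^sup>+\<omega>. e * indicator {\<omega>\<in>space M. e \<le> g \<omega>} \<omega> \<partial>M)"
    by (simp add: nn_integral_cmult_indicator)
  also have "\<dots> \<le> (\<integral>\<^sup>+\<omega>. g \<omega> \<partial>M)"
    by (intro nn_integral_mono) (auto split: split_indicator)
  finally have "e * emeasure M {\<omega>\<in>space M. e \<le> g \<omega>} \<le> e * r" using int by simp
  then show ?thesis using e by (simp add: ennreal_mult_le_mult_iff)
qed

lemma Markov_in_prob:
  fixes h :: "nat \<Rightarrow> 'a \<Rightarrow> ennreal"
  assumes meas: "\<forall>\<^sub>F n in sequentially. h n \<in> borel_measurable M"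
    and lim: "(\<lambda>n. \<integral>\<^sup>+\<omega>. h n \<omega> \<partial>M) \<longlonglongrightarrow> 0"
  shows "((\<lambda>(n, \<omega>). h n \<omega>) \<longlongrightarrow> 0) (in_prob M)"
proof (rule order_tendstoI)
  fix d :: ennreal assume "0 < d"
  then obtain e where e: "0 < e" "e < d" using dense by blast
  show "\<forall>\<^sub>F x in in_prob M. (case x of (n, \<omega>) \<Rightarrow> h n \<omega>) < d"
    unfolding eventually_in_prob
  proof (intro allI impI)
    fix r :: real assume "0 < r"
    have "0 < e * ennreal r" using e \<open>0 < r\<close> by (simp add: ennreal_zero_less_mult_iff)
    then have "\<forall>\<^sub>F n in sequentially. (\<integral>\<^sup>+\<omega>. h n \<omega> \<partial>M) < e * ennreal r"
      using order_tendstoD(2)[OF lim] by blast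
    then show "\<forall>\<^sub>F n in sequentially. \<exists>A\<in>sets M. emeasure M A \<le> ennreal r \<and>
       (\<forall>\<omega>\<in>space M - A. (case (n, \<omega>) of (n, \<omega>) \<Rightarrow> h n \<omega>) < d)"
      using meas
    proof eventually_elim
      case (elim n)
      have [measurable]: "h n \<in> borel_measurable M" by fact
      have e_top: "e \<noteq> \<top>" "e \<noteq> 0" using e by auto
      have "emeasure M {\<omega>\<in>space M. e \<le> h n \<omega>} \<le> ennreal r"
        using elim e_top by (intro Markov_ennreal) auto
      then show ?case
        using e by (intro bexI[of _ "{\<omega>\<in>space M. e \<le> h n \<omega>}"]) auto
    qed
  qed
qed simp

text \<open>
  This is how sample splitting is exploited. By independence the pair \<open>(D n, E n)\<close> has a product
  law, so conditioning on \<open>D n\<close> means averaging over \<open>E n\<close> with \<open>D n\<close> held fixed. Outside a rare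
  event depending on \<open>D n\<close> this average is small. Markov's inequality is applied to \<open>h\<close> set to 0 on
  that event, since the unconditional mean of \<open>h\<close> may well be infinite.
\<close>

lemma conditional_Markov_in_prob:
  fixes h :: "nat \<Rightarrow> 'b \<times> 'b \<Rightarrow> ennreal"
  assumes M: "prob_space M"
    and ind: "\<forall>\<^sub>F n in sequentially. prob_space.indep_var M (S n) (D n) (T n) (E n)"
    and meas: "\<forall>\<^sub>F n in sequentially. h n \<in> borel_measurable (S n \<Otimes>\<^sub>M T n)"
    and lim: "((\<lambda>(n, \<omega>). \<integral>\<^sup>+\<omega>'. h n (D n \<omega>, E n \<omega>') \<partial>M) \<longlongrightarrow> 0) (in_prob M)"
  shows "((\<lambda>(n, \<omega>). h n (D n \<omega>, E n \<omega>)) \<longlongrightarrow> 0) (in_prob M)"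
proof (rule order_tendstoI)
  interpret prob_space M by fact
  fix d :: ennreal assume "0 < d"
  then obtain e where e: "0 < e" "e < d" using dense by blast
  show "\<forall>\<^sub>F x in in_prob M. (case x of (n, \<omega>) \<Rightarrow> h n (D n \<omega>, E n \<omega>)) < d"
    unfolding eventually_in_prob
  proof (intro allI impI)
    fix r :: real assume "0 < r"
    then have r2: "0 < r / 2" by simp
    have "0 < e * ennreal (r / 2)" using e r2 by (simp add: ennreal_zero_less_mult_iff)
    from order_tendstoD(2)[OF lim this]
    have "\<forall>\<^sub>F n in sequentially. \<exists>A\<in>sets M. emeasure M A \<le> ennreal (r / 2) \<and>
        (\<forall>\<omega>\<in>space M - A. (\<integral>\<^sup>+\<omega>'. h n (D n \<omega>, E n \<omega>') \<partial>M) < e * ennreal (r / 2))"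
      using r2 unfolding eventually_in_prob by simp
    then show "\<forall>\<^sub>F n in sequentially. \<exists>A\<in>sets M. emeasure M A \<le> ennreal r \<and>
       (\<forall>\<omega>\<in>space M - A. (case (n, \<omega>) of (n, \<omega>) \<Rightarrow> h n (D n \<omega>, E n \<omega>)) < d)"
      using meas ind
    proof eventually_elim
      case (elim n)
      then obtain A where A[measurable]: "A \<in> sets M" and A_small: "emeasure M A \<le> ennreal (r / 2)"
        and A_good: "\<And>\<omega>. \<omega> \<in> space M \<Longrightarrow> \<omega> \<notin> A \<Longrightarrow>
          (\<integral>\<^sup>+\<omega>'. h n (D n \<omega>, E n \<omega>') \<partial>M) < e * ennreal (r / 2)" by blast
      have h[measurable]: "h n \<in> borel_measurable (S n \<Otimes>\<^sub>M T n)" by fact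
      have D[measurable]: "D n \<in> measurable M (S n)" and E[measurable]: "E n \<in> measurable M (T n)"
        and law: "distr M (S n) (D n) \<Otimes>\<^sub>M distr M (T n) (E n) =
          distr M (S n \<Otimes>\<^sub>M T n) (\<lambda>\<omega>. (D n \<omega>, E n \<omega>))"
        using elim(3) unfolding indep_var_distribution_eq by auto
      interpret DS: prob_space "distr M (S n) (D n)" by (rule prob_space_distr) simp
      interpret ET: prob_space "distr M (T n) (E n)" by (rule prob_space_distr) simp
      define \<nu> where "\<nu> d = (\<integral>\<^sup>+w. h n (d, w) \<partial>distr M (T n) (E n))" for d
      have [measurable]: "\<nu> \<in> borel_measurable (S n)"
        unfolding \<nu>_def by measurable
      define g where "g = (\<lambda>(d, w). indicator {d \<in> space (S n). \<nu> d < e * ennreal (r / 2)} d * h n (d, w))"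
      have g[measurable]: "g \<in> borel_measurable (S n \<Otimes>\<^sub>M T n)"
        unfolding g_def by measurable
      have \<nu>_eq: "\<nu> d = (\<integral>\<^sup>+\<omega>'. h n (d, E n \<omega>') \<partial>M)" if "d \<in> space (S n)" for d
        unfolding \<nu>_def using that by (intro nn_integral_distr) auto
      have "(\<integral>\<^sup>+\<omega>. g (D n \<omega>, E n \<omega>) \<partial>M) = (\<integral>\<^sup>+x. g x \<partial>(distr M (S n) (D n) \<Otimes>\<^sub>M distr M (T n) (E n)))"
        unfolding law by (subst nn_integral_distr) auto
      also have "\<dots> = (\<integral>\<^sup>+d. \<integral>\<^sup>+w. g (d, w) \<partial>distr M (T n) (E n) \<partial>distr M (S n) (D n))"
        by (rule ET.nn_integral_fst[symmetric]) simp
      also have "\<dots> = (\<integral>\<^sup>+d. indicator {d \<in> space (S n). \<nu> d < e * ennreal (r / 2)} d * \<nu> d \<partial>distr M (S n) (D n))"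
        unfolding g_def \<nu>_def prod.case by (intro nn_integral_cong nn_integral_cmult) auto
      also have "\<dots> \<le> (\<integral>\<^sup>+d. e * ennreal (r / 2) \<partial>distr M (S n) (D n))"
        by (intro nn_integral_mono) (auto split: split_indicator)
      also have "\<dots> = e * ennreal (r / 2)"
        by (simp only: nn_integral_const DS.emeasure_space_1 mult_1_right)
      finally have g_int: "(\<integral>\<^sup>+\<omega>. g (D n \<omega>, E n \<omega>) \<partial>M) \<le> e * ennreal (r / 2)" .
      have e_top: "e \<noteq> \<top>" "e \<noteq> 0" using e by auto
      let ?B = "{\<omega>\<in>space M. e \<le> g (D n \<omega>, E n \<omega>)}"
      have B: "emeasure M ?B \<le> ennreal (r / 2)"
        using g_int e_top by (intro Markov_ennreal) auto
      have "emeasure M (A \<union> ?B) \<le> emeasure M A + emeasure M ?B"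
        by (intro emeasure_subadditive) auto
      also have "\<dots> \<le> ennreal (r / 2) + ennreal (r / 2)"
        using A_small B by (intro add_mono)
      also have "\<dots> = ennreal r"
        using \<open>0 < r\<close> by (simp flip: ennreal_plus)
      finally have "emeasure M (A \<union> ?B) \<le> ennreal r" .
      moreover have "h n (D n \<omega>, E n \<omega>) < d" if \<omega>: "\<omega> \<in> space M - (A \<union> ?B)" for \<omega>
      proof -
        have "\<nu> (D n \<omega>) < e * ennreal (r / 2)"
          using \<omega> A_good[of \<omega>] \<nu>_eq[of "D n \<omega>"] measurable_space[OF D, of \<omega>] by auto
        then have "g (D n \<omega>, E n \<omega>) = h n (D n \<omega>, E n \<omega>)"
          using \<omega> measurable_space[OF D, of \<omega>] by (auto simp: g_def)
        then have "h n (D n \<omega>, E n \<omega>) < e" using \<omega> by auto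
        then show ?thesis using e by simp
      qed
      ultimately show ?case
        by (intro bexI[of _ "A \<union> ?B"]) auto
    qed
  qed
qed simp

lemma tendsto_zero_of_ennreal:
  fixes f :: "'b \<Rightarrow> real"
  assumes "\<And>x. 0 \<le> f x" "((\<lambda>x. ennreal (f x)) \<longlongrightarrow> 0) F"
  shows "(f \<longlongrightarrow> 0) F"
proof (rule tendsto_ennrealD)
  show "((\<lambda>x. ennreal (f x)) \<longlongrightarrow> ennreal 0) F" using assms(2) by simp
qed (use assms(1) in auto)

lemma tendsto_zero_of_ennreal_square:
  fixes f :: "'b \<Rightarrow> real"
  assumes "((\<lambda>x. ennreal ((f x)\<^sup>2)) \<longlongrightarrow> 0) F"
  shows "(f \<longlongrightarrow> 0) F"
proof -
  have "((\<lambda>x. (f x)\<^sup>2) \<longlongrightarrow> 0) F"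
    by (rule tendsto_zero_of_ennreal[OF _ assms]) simp
  from tendsto_real_sqrt[OF this] show ?thesis
    by (simp add: tendsto_rabs_zero_iff)
qed

section \<open>Weak convergence to a normal law\<close>

text \<open>
  Outside a small event \<open>V n\<close> is within \<open>t\<close> of \<open>U n\<close>. Hence the distribution function of \<open>V n\<close> at
  \<open>x\<close> lies, up to a small error, between those of \<open>U n\<close> at \<open>x - t\<close> and \<open>x + t\<close>, and the limiting
  distribution function is continuous.
\<close>

lemma Slutsky_weak_conv:
  fixes U V :: "nat \<Rightarrow> 'a \<Rightarrow> real"
  assumes M: "prob_space M" and N: "real_distribution N"
    and U: "\<forall>\<^sub>F n in sequentially. U n \<in> borel_measurable M"
    and V: "\<forall>\<^sub>F n in sequentially. V n \<in> borel_measurable M"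
    and conv: "weak_conv_m (\<lambda>n. distr M borel (U n)) N"
    and no_atoms: "\<And>x. measure N {x} = 0"
    and diff: "((\<lambda>(n, \<omega>). V n \<omega> - U n \<omega>) \<longlongrightarrow> 0) (in_prob M)"
  shows "weak_conv_m (\<lambda>n. distr M borel (V n)) N"
  unfolding weak_conv_m_def weak_conv_def
proof (intro allI impI)
  fix x
  interpret prob_space M by fact
  interpret N: real_distribution N by fact
  have cont: "isCont (cdf N) y" for y using no_atoms by (simp add: N.isCont_cdf)
  have cdf_U: "(\<lambda>n. cdf (distr M borel (U n)) y) \<longlonglongrightarrow> cdf N y" for y
    using conv cont unfolding weak_conv_m_def weak_conv_def by blast
  have cdf_eq: "cdf (distr M borel f) y = measure M {\<omega>\<in>space M. f \<omega> \<le> y}"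
    if [measurable]: "f \<in> borel_measurable M" for f y
    unfolding cdf_def by (subst measure_distr) (auto intro!: arg_cong[where f = "measure M"])
  show "(\<lambda>n. cdf (distr M borel (V n)) x) \<longlonglongrightarrow> cdf N x"
  proof (rule tendstoI)
    fix e :: real assume "0 < e"
    then have e3: "0 < e / 3" by simp
    obtain \<delta> where \<delta>: "0 < \<delta>" "\<And>y. dist y x < \<delta> \<Longrightarrow> dist (cdf N y) (cdf N x) < e / 3"
      using cont[of x] e3 unfolding continuous_at_eps_delta dist_real_def by metis
    define t where "t = \<delta> / 2"
    have t: "0 < t" "dist (cdf N (x + t)) (cdf N x) < e / 3" "dist (cdf N (x - t)) (cdf N x) < e / 3"
      using \<delta> by (auto simp: t_def dist_real_def)
    have "\<forall>\<^sub>F n in sequentially. \<exists>A\<in>sets M. emeasure M A \<le> ennreal (e / 3) \<and>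
        (\<forall>\<omega>\<in>space M - A. dist (V n \<omega> - U n \<omega>) 0 < t)"
      using tendstoD[OF diff t(1)] e3 unfolding eventually_in_prob by simp
    then show "\<forall>\<^sub>F n in sequentially. dist (cdf (distr M borel (V n)) x) (cdf N x) < e"
      using U V tendstoD[OF cdf_U[of "x + t"] e3] tendstoD[OF cdf_U[of "x - t"] e3]
    proof eventually_elim
      case (elim n)
      have [measurable]: "U n \<in> borel_measurable M" "V n \<in> borel_measurable M" by fact+
      obtain A where [measurable]: "A \<in> sets M" and A: "emeasure M A \<le> ennreal (e / 3)"
        "\<And>\<omega>. \<omega> \<in> space M - A \<Longrightarrow> \<bar>V n \<omega> - U n \<omega>\<bar> < t"
        using elim(1) by (auto simp: dist_real_def)
      have pA: "prob A \<le> e / 3"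
        using A(1) e3 by (simp add: emeasure_eq_measure)
      have "prob {\<omega>\<in>space M. V n \<omega> \<le> x} \<le> prob ({\<omega>\<in>space M. U n \<omega> \<le> x + t} \<union> A)"
        using A(2) by (intro finite_measure_mono) (auto, smt (verit) Diff_iff)
      also have "\<dots> \<le> prob {\<omega>\<in>space M. U n \<omega> \<le> x + t} + prob A"
        by (intro measure_Un_le) auto
      finally have up: "prob {\<omega>\<in>space M. V n \<omega> \<le> x} \<le> prob {\<omega>\<in>space M. U n \<omega> \<le> x + t} + e / 3"
        using pA by simp
      have "prob {\<omega>\<in>space M. U n \<omega> \<le> x - t} \<le> prob ({\<omega>\<in>space M. V n \<omega> \<le> x} \<union> A)"
        using A(2) by (intro finite_measure_mono) (auto, smt (verit) Diff_iff)
      also have "\<dots> \<le> prob {\<omega>\<in>space M. V n \<omega> \<le> x} + prob A"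
        by (intro measure_Un_le) auto
      finally have down: "prob {\<omega>\<in>space M. U n \<omega> \<le> x - t} \<le> prob {\<omega>\<in>space M. V n \<omega> \<le> x} + e / 3"
        using pA by simp
      show ?case
        using up down elim(4,5) t unfolding dist_real_def abs_less_iff
        by (simp add: cdf_eq)
    qed
  qed
qed

lemma weak_conv_m_subseq:
  assumes "weak_conv_m L N" "strict_mono r"
  shows "weak_conv_m (\<lambda>n. L (r n)) N"
  unfolding weak_conv_m_def weak_conv_def
proof (intro allI impI)
  fix x assume "isCont (cdf N) x"
  then have "(\<lambda>n. cdf (L n) x) \<longlonglongrightarrow> cdf N x"
    using assms(1) unfolding weak_conv_m_def weak_conv_def by blast
  from LIMSEQ_subseq_LIMSEQ[OF this assms(2)] show "(\<lambda>n. cdf (L (r n)) x) \<longlonglongrightarrow> cdf N x"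
    by (simp add: comp_def)
qed

lemma std_normal_no_atoms: "measure std_normal_distribution {x} = 0"
proof -
  have "AE y in lborel. y \<in> {x} \<longrightarrow> ennreal (std_normal_density y) = 0"
    using AE_lborel_singleton[of x] by eventually_elim simp
  then have "{x} \<in> null_sets std_normal_distribution"
    by (subst null_sets_density_iff) auto
  then show ?thesis by (simp add: measure_def null_setsD1)
qed

lemma weak_conv_std_normal_scale:
  fixes V :: "nat \<Rightarrow> 'a \<Rightarrow> real"
  assumes c: "0 < c" and V: "\<forall>\<^sub>F n in sequentially. V n \<in> borel_measurable M"
    and conv: "weak_conv_m (\<lambda>n. distr M borel (\<lambda>\<omega>. V n \<omega> / c)) std_normal_distribution"
  shows "weak_conv_m (\<lambda>n. distr M borel (V n)) (density lborel (\<lambda>x. ennreal (normal_density 0 c x)))"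
proof -
  let ?N = "density lborel (\<lambda>x. ennreal (normal_density 0 c x))"
  interpret S: real_distribution std_normal_distribution by (rule real_dist_normal_dist)
  have "distributed std_normal_distribution lborel (\<lambda>x. x) std_normal_density"
    unfolding distributed_def by (auto intro!: measure_eqI simp: emeasure_distr)
  then have "distributed std_normal_distribution lborel (\<lambda>x. (c * x - 0) / c) std_normal_density"
    using c by simp
  then have "distributed std_normal_distribution lborel (\<lambda>x. c * x) (normal_density 0 c)"
    using S.normal_standard_normal_convert[OF c, of "\<lambda>x. c * x" 0] by simp
  then have N: "distr std_normal_distribution lborel (\<lambda>x. c * x) = ?N"
    by (rule distributed_distr_eq_density)
  have cdf_N: "cdf ?N x = cdf std_normal_distribution (x / c)" for x
  proof -
    have "cdf ?N x = measure std_normal_distribution ((\<lambda>x. c * x) -` {..x} \<inter> space std_normal_distribution)"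
      unfolding cdf_def N[symmetric] by (rule measure_distr) auto
    also have "(\<lambda>x. c * x) -` {..x} \<inter> space std_normal_distribution = {..x / c}"
      using c by (auto simp: field_simps)
    finally show ?thesis by (simp add: cdf_def)
  qed
  have cdf_V: "cdf (distr M borel (V n)) x = cdf (distr M borel (\<lambda>\<omega>. V n \<omega> / c)) (x / c)"
    if [measurable]: "V n \<in> borel_measurable M" for n x
    unfolding cdf_def using c
    by (subst (1 2) measure_distr) (auto intro!: arg_cong[where f = "measure M"] simp: divide_le_cancel)
  show ?thesis
    unfolding weak_conv_m_def weak_conv_def
  proof (intro allI impI)
    fix x
    have "isCont (cdf std_normal_distribution) (x / c)"
      by (simp add: S.isCont_cdf std_normal_no_atoms)
    then have "(\<lambda>n. cdf (distr M borel (\<lambda>\<omega>. V n \<omega> / c)) (x / c)) \<longlonglongrightarrow> cdf ?N x"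
      using conv unfolding weak_conv_m_def weak_conv_def cdf_N by blast
    moreover have "\<forall>\<^sub>F n in sequentially. cdf (distr M borel (\<lambda>\<omega>. V n \<omega> / c)) (x / c) = cdf (distr M borel (V n)) x"
      using V by eventually_elim (simp add: cdf_V)
    ultimately show "(\<lambda>n. cdf (distr M borel (V n)) x) \<longlonglongrightarrow> cdf ?N x"
      by (rule Lim_transform_eventually)
  qed
qed

section \<open>Linearising the correlation coefficient\<close>

text \<open>
  With \<open>D = sqrt (A * B)\<close> the remainder is \<open>\<rho> * ((A + B) / 2 - D) - (D - 1) / D * (C - \<rho> * D)\<close>,
  where \<open>(A + B) / 2 - D = (A - B)\<^sup>2 / (2 * (sqrt A + sqrt B)\<^sup>2)\<close>. Each summand contains a product
  of two deviations that vanish even after multiplication by \<open>q\<close>, which is why \<open>q\<^sup>2\<close> times the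
  remainder vanishes.
\<close>

lemma correlation_linearisation:
  fixes q A B C :: "'b \<Rightarrow> real" and \<rho> :: real
  assumes q: "\<forall>\<^sub>F x in F. 1 \<le> q x"
    and A: "((\<lambda>x. q x * (A x - 1)) \<longlongrightarrow> 0) F"
    and B: "((\<lambda>x. q x * (B x - 1)) \<longlongrightarrow> 0) F"
    and C: "((\<lambda>x. q x * (C x - \<rho>)) \<longlongrightarrow> 0) F"
  shows "((\<lambda>x. (q x)\<^sup>2 * (C x / (sqrt (A x) * sqrt (B x)) - \<rho> - (C x - \<rho> * (A x + B x) / 2))) \<longlongrightarrow> 0) F"
proof -
  have unscale: "((\<lambda>x. f x) \<longlongrightarrow> 1) F" if "((\<lambda>x. q x * (f x - 1)) \<longlongrightarrow> 0) F" for f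
  proof -
    have "((\<lambda>x. f x - 1) \<longlongrightarrow> 0) F"
    proof (rule Lim_null_comparison[OF _ tendsto_norm_zero[OF that]])
      show "\<forall>\<^sub>F x in F. norm (f x - 1) \<le> norm (q x * (f x - 1))"
        using q by eventually_elim (simp add: abs_mult mult_le_cancel_right1)
    qed
    then show ?thesis using LIM_zero_cancel by blast
  qed
  have A1: "(A \<longlongrightarrow> 1) F" and B1: "(B \<longlongrightarrow> 1) F" using unscale[OF A] unscale[OF B] .
  have pos: "\<forall>\<^sub>F x in F. 0 < A x" "\<forall>\<^sub>F x in F. 0 < B x"
    using order_tendstoD(1)[OF A1] order_tendstoD(1)[OF B1] by auto
  define D where "D x = sqrt (A x) * sqrt (B x)" for x
  have D1: "(D \<longlongrightarrow> 1) F"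
    unfolding D_def by (rule tendsto_eq_intros A1 B1 refl | simp)+
  \<comment> \<open>this is \<open>q * (D - 1)\<close>, in a form whose limit can be read off\<close>
  define u where "u x = (q x * (A x - 1) * B x + q x * (B x - 1)) / (D x + 1)" for x
  have u: "(u \<longlongrightarrow> 0) F"
    unfolding u_def by (rule tendsto_eq_intros A B A1 B1 D1 refl | simp)+
  have "((\<lambda>x. - u x / D x * (q x * (C x - \<rho>) - \<rho> * u x)
     + \<rho> * (q x * (A x - 1) - q x * (B x - 1))\<^sup>2 / (2 * (sqrt (A x) + sqrt (B x))\<^sup>2)) \<longlongrightarrow> 0) F"
    by (rule tendsto_eq_intros A B C A1 B1 D1 u refl | simp)+
  moreover have "\<forall>\<^sub>F x in F. - u x / D x * (q x * (C x - \<rho>) - \<rho> * u x)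
     + \<rho> * (q x * (A x - 1) - q x * (B x - 1))\<^sup>2 / (2 * (sqrt (A x) + sqrt (B x))\<^sup>2) =
     (q x)\<^sup>2 * (C x / (sqrt (A x) * sqrt (B x)) - \<rho> - (C x - \<rho> * (A x + B x) / 2))"
    using pos
  proof eventually_elim
    case (elim x)
    define a b where "a = sqrt (A x)" and "b = sqrt (B x)"
    have ab: "0 < a" "0 < b" "A x = a\<^sup>2" "B x = b\<^sup>2" using elim by (auto simp: a_def b_def)
    have D: "D x = a * b" by (simp add: D_def a_def b_def)
    have "0 < a * b" using ab by simp
    have "q x * (A x - 1) * B x + q x * (B x - 1) = q x * (a * b - 1) * (a * b + 1)"
      unfolding ab by (simp add: algebra_simps power2_eq_square)
    then have u: "u x = q x * (a * b - 1)"
      unfolding u_def D using \<open>0 < a * b\<close> by (simp add: field_simps)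
    have "(q x * (A x - 1) - q x * (B x - 1))\<^sup>2 = (q x)\<^sup>2 * (a - b)\<^sup>2 * (a + b)\<^sup>2"
      unfolding ab by (simp add: algebra_simps power2_eq_square)
    then have *: "\<rho> * (q x * (A x - 1) - q x * (B x - 1))\<^sup>2 / (2 * (a + b)\<^sup>2) = \<rho> * (q x)\<^sup>2 * (a - b)\<^sup>2 / 2"
      using ab(1,2) by (simp add: field_simps)
    show ?case
      unfolding u D * a_def[symmetric] b_def[symmetric]
      unfolding ab using ab(1,2) by (simp add: field_simps power2_eq_square)
  qed
  ultimately show ?thesis
    by (rule Lim_transform_eventually)
qed

lemma residual_corr_scale:
  assumes "0 < c" "0 < d" "0 < n"
  shows "residual_corr J (\<lambda>i. c * u i) (\<lambda>i. d * v i) =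
    ((\<Sum>i\<in>J. u i * v i) / n) / (sqrt ((\<Sum>i\<in>J. (u i)\<^sup>2) / n) * sqrt ((\<Sum>i\<in>J. (v i)\<^sup>2) / n))"
proof -
  have "(\<Sum>i\<in>J. (c * u i) * (d * v i)) = c * d * (\<Sum>i\<in>J. u i * v i)"
    unfolding sum_distrib_left by (rule sum.cong) (simp_all add: mult_ac)
  moreover have "sqrt (\<Sum>i\<in>J. (c * u i)\<^sup>2) = c * sqrt (\<Sum>i\<in>J. (u i)\<^sup>2)"
    using assms by (simp add: power_mult_distrib real_sqrt_mult flip: sum_distrib_left)
  moreover have "sqrt (\<Sum>i\<in>J. (d * v i)\<^sup>2) = d * sqrt (\<Sum>i\<in>J. (v i)\<^sup>2)"
    using assms by (simp add: power_mult_distrib real_sqrt_mult flip: sum_distrib_left)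
  moreover have "sqrt n * sqrt n = n" using assms by simp
  ultimately show ?thesis
    unfolding residual_corr_def real_sqrt_divide using assms by (simp add: field_simps)
qed

section \<open>Moments of bivariate normal errors\<close>

text \<open>
  The map \<open>(a, b) \<mapsto> (\<sigma>x * a, \<sigma>y * \<rho> * a + \<sigma>y * s * b)\<close> has Jacobian \<open>\<sigma>x * \<sigma>y * s\<close> and turns the
  quadratic form in the exponent into \<open>(1 - \<rho>\<^sup>2) * (a\<^sup>2 + b\<^sup>2)\<close>.
\<close>

lemma standardised_density:
  fixes a b \<sigma>x \<sigma>y \<rho> :: real
  assumes "0 < \<sigma>x" "0 < \<sigma>y" "- 1 < \<rho>" "\<rho> < 1"
  defines "s \<equiv> sqrt (1 - \<rho>\<^sup>2)"
  shows "\<sigma>x * (\<sigma>y * s * bivariate_normal_density \<sigma>x \<sigma>y \<rho> (\<sigma>x * a, \<sigma>y * \<rho> * a + \<sigma>y * s * b)) =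
    std_normal_density a * std_normal_density b"
proof -
  have "\<rho>\<^sup>2 < 1" using assms by (simp add: abs_square_less_1)
  then have s: "0 < s" "s\<^sup>2 = 1 - \<rho>\<^sup>2" by (simp_all add: s_def)
  have v: "(\<sigma>y * \<rho> * a + \<sigma>y * s * b) / \<sigma>y = \<rho> * a + s * b" "\<sigma>x * a / \<sigma>x = a"
    using assms by (simp_all add: field_simps)
  have "(a\<^sup>2 - 2 * \<rho> * a * (\<rho> * a + s * b) + (\<rho> * a + s * b)\<^sup>2) = (1 - \<rho>\<^sup>2) * a\<^sup>2 + s\<^sup>2 * b\<^sup>2"
    by (simp add: algebra_simps power2_eq_square)
  also have "\<dots> = (1 - \<rho>\<^sup>2) * (a\<^sup>2 + b\<^sup>2)" unfolding s by (simp add: algebra_simps)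
  finally have e: "- (a\<^sup>2 - 2 * \<rho> * a * (\<rho> * a + s * b) + (\<rho> * a + s * b)\<^sup>2) / (2 * (1 - \<rho>\<^sup>2)) = - a\<^sup>2 / 2 + - b\<^sup>2 / 2"
    using \<open>\<rho>\<^sup>2 < 1\<close> by (simp add: field_simps)
  have "sqrt (2 * pi) * sqrt (2 * pi) = 2 * pi" by simp
  then have "std_normal_density a * std_normal_density b = 1 / (2 * pi) * exp (- a\<^sup>2 / 2 + - b\<^sup>2 / 2)"
    unfolding std_normal_density_def exp_add by (simp add: field_simps)
  moreover have "\<sigma>x * (\<sigma>y * s * bivariate_normal_density \<sigma>x \<sigma>y \<rho> (\<sigma>x * a, \<sigma>y * \<rho> * a + \<sigma>y * s * b)) =
     1 / (2 * pi) * exp (- a\<^sup>2 / 2 + - b\<^sup>2 / 2)"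
    unfolding bivariate_normal_density_def prod.case v e s_def[symmetric] using assms(1,2) s(1)
    by (simp add: field_simps)
  ultimately show ?thesis by simp
qed

text \<open>
  Subtracting from the second standardised error its regression on the first leaves, after
  rescaling, a standard normal variable independent of the first.
\<close>

lemma (in prob_space) bivariate_normal_standardise:
  fixes \<sigma>x \<sigma>y \<rho> :: real
  assumes D: "distributed M lborel (\<lambda>\<omega>. (ex \<omega>, ey \<omega>))
      (\<lambda>e. ennreal (bivariate_normal_density \<sigma>x \<sigma>y \<rho> e))"
    and pos: "0 < \<sigma>x" "0 < \<sigma>y" "- 1 < \<rho>" "\<rho> < 1"
  defines "s \<equiv> sqrt (1 - \<rho>\<^sup>2)"
  shows "distr M (borel \<Otimes>\<^sub>M borel) (\<lambda>\<omega>. (ex \<omega> / \<sigma>x, (ey \<omega> / \<sigma>y - \<rho> * (ex \<omega> / \<sigma>x)) / s)) =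
    density lborel std_normal_density \<Otimes>\<^sub>M density lborel std_normal_density" (is "?L = ?R")
proof (rule measure_eqI)
  show "sets ?L = sets ?R" by (simp cong: sets_pair_measure_cong)
  fix A assume "A \<in> sets ?L"
  then have A[measurable]: "A \<in> sets (borel \<Otimes>\<^sub>M borel)" by simp
  have "\<rho>\<^sup>2 < 1" using pos by (simp add: abs_square_less_1)
  then have s: "0 < s" by (simp add: s_def)
  have pair[measurable]: "(\<lambda>\<omega>. (ex \<omega>, ey \<omega>)) \<in> borel_measurable M"
    using distributed_measurable[OF D] by simp
  have [measurable]: "ex \<in> borel_measurable M" "ey \<in> borel_measurable M"
    using measurable_compose[OF pair, of fst borel] measurable_compose[OF pair, of snd borel]
    by (simp_all add: borel_prod[symmetric])
  define T where "T = (\<lambda>(u, v). (u / \<sigma>x, (v / \<sigma>y - \<rho> * (u / \<sigma>x)) / s))"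
  have T[measurable]: "T \<in> measurable (borel \<Otimes>\<^sub>M borel) (borel \<Otimes>\<^sub>M borel)"
    unfolding T_def by measurable
  have dens[measurable]: "(\<lambda>e. ennreal (bivariate_normal_density \<sigma>x \<sigma>y \<rho> e)) \<in> borel_measurable (borel \<Otimes>\<^sub>M borel)"
    unfolding bivariate_normal_density_def by measurable
  let ?f = "\<lambda>e. ennreal (bivariate_normal_density \<sigma>x \<sigma>y \<rho> e) * indicator A (T e)"
  have f[measurable]: "?f \<in> borel_measurable (borel \<Otimes>\<^sub>M borel)" by measurable
  have "emeasure ?L A = (\<integral>\<^sup>+\<omega>. indicator A (T (ex \<omega>, ey \<omega>)) \<partial>M)"
    by (subst emeasure_distr) (auto simp: T_def simp flip: nn_integral_indicator
        intro!: nn_integral_cong split: split_indicator)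
  also have "\<dots> = (\<integral>\<^sup>+e. ?f e \<partial>lborel)"
    by (subst distributed_nn_integral[OF D, symmetric]) (auto simp: borel_prod[symmetric])
  also have "\<dots> = (\<integral>\<^sup>+e. ?f e \<partial>(lborel \<Otimes>\<^sub>M lborel))"
    by (simp add: lborel_prod)
  also have "\<dots> = (\<integral>\<^sup>+u. \<integral>\<^sup>+v. ?f (u, v) \<partial>lborel \<partial>lborel)"
    by (rule lborel.nn_integral_fst[symmetric]) simp
  also have "\<dots> = (\<integral>\<^sup>+u. ennreal (\<sigma>y * s) * (\<integral>\<^sup>+b. ?f (u, \<sigma>y * \<rho> * (u / \<sigma>x) + \<sigma>y * s * b) \<partial>lborel) \<partial>lborel)"
  proof (rule nn_integral_cong)
    fix u
    show "(\<integral>\<^sup>+v. ?f (u, v) \<partial>lborel) = ennreal (\<sigma>y * s) * (\<integral>\<^sup>+b. ?f (u, \<sigma>y * \<rho> * (u / \<sigma>x) + \<sigma>y * s * b) \<partial>lborel)"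
      using pos s
      by (subst nn_integral_real_affine[of _ "\<sigma>y * s" "\<sigma>y * \<rho> * (u / \<sigma>x)"]) auto
  qed
  also have "\<dots> = ennreal \<sigma>x * (\<integral>\<^sup>+a. ennreal (\<sigma>y * s) * (\<integral>\<^sup>+b. ?f (\<sigma>x * a, \<sigma>y * \<rho> * a + \<sigma>y * s * b) \<partial>lborel) \<partial>lborel)"
    using pos by (subst nn_integral_real_affine[of _ "\<sigma>x" 0]) auto
  also have "\<dots> = (\<integral>\<^sup>+a. \<integral>\<^sup>+b. ennreal \<sigma>x * (ennreal (\<sigma>y * s) * ?f (\<sigma>x * a, \<sigma>y * \<rho> * a + \<sigma>y * s * b)) \<partial>lborel \<partial>lborel)"
    by (simp add: nn_integral_cmult)
  also have "\<dots> = (\<integral>\<^sup>+a. \<integral>\<^sup>+b. ennreal (std_normal_density a) * ennreal (std_normal_density b) * indicator A (a, b) \<partial>lborel \<partial>lborel)"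
  proof (intro nn_integral_cong)
    fix a b
    have "T (\<sigma>x * a, \<sigma>y * \<rho> * a + \<sigma>y * s * b) = (a, b)"
      using pos s by (simp add: T_def field_simps)
    then have "ennreal \<sigma>x * (ennreal (\<sigma>y * s) * ?f (\<sigma>x * a, \<sigma>y * \<rho> * a + \<sigma>y * s * b)) =
      ennreal (\<sigma>x * (\<sigma>y * s * bivariate_normal_density \<sigma>x \<sigma>y \<rho> (\<sigma>x * a, \<sigma>y * \<rho> * a + \<sigma>y * s * b))) * indicator A (a, b)"
      using pos s by (simp add: ennreal_mult' mult.assoc)
    also have "\<dots> = ennreal (std_normal_density a * std_normal_density b) * indicator A (a, b)"
      using standardised_density[OF pos, of a b] by (simp only: s_def)
    finally show "ennreal \<sigma>x * (ennreal (\<sigma>y * s) * ?f (\<sigma>x * a, \<sigma>y * \<rho> * a + \<sigma>y * s * b)) =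
       ennreal (std_normal_density a) * ennreal (std_normal_density b) * indicator A (a, b)"
      by (simp add: ennreal_mult' normal_density_nonneg)
  qed
  also have "\<dots> = (\<integral>\<^sup>+x. (case x of (a, b) \<Rightarrow> ennreal (std_normal_density a) * ennreal (std_normal_density b)) * indicator A x \<partial>(lborel \<Otimes>\<^sub>M lborel))"
    by (subst lborel.nn_integral_fst[symmetric]) auto
  also have "\<dots> = emeasure (density (lborel \<Otimes>\<^sub>M lborel) (\<lambda>(a, b). ennreal (std_normal_density a) * ennreal (std_normal_density b))) A"
    by (subst emeasure_density) auto
  also have "\<dots> = emeasure ?R A"
    by (subst pair_measure_density)
      (auto intro!: lborel.sigma_finite_measure_axioms prob_space_imp_sigma_finite prob_space_normal_density)
  finally show "emeasure ?L A = emeasure ?R A" .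
qed

definition std_normal_moment :: "nat \<Rightarrow> real" where
  "std_normal_moment k = (if even k then fact k / (2 ^ (k div 2) * fact (k div 2)) else 0)"

lemma std_normal_moment_values:
  "std_normal_moment 0 = 1" "std_normal_moment 1 = 0" "std_normal_moment 2 = 1"
  "std_normal_moment 3 = 0" "std_normal_moment 4 = 3"
  by (simp_all add: std_normal_moment_def fact_numeral)

lemma (in prob_space) bivariate_normal_moments:
  fixes \<sigma>x \<sigma>y \<rho> :: real
  assumes D: "distributed M lborel (\<lambda>\<omega>. (ex \<omega>, ey \<omega>))
      (\<lambda>e. ennreal (bivariate_normal_density \<sigma>x \<sigma>y \<rho> e))"
    and pos: "0 < \<sigma>x" "0 < \<sigma>y" "- 1 < \<rho>" "\<rho> < 1"
  defines "s \<equiv> sqrt (1 - \<rho>\<^sup>2)"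
  shows "has_bochner_integral M
    (\<lambda>\<omega>. (ex \<omega> / \<sigma>x) ^ i * ((ey \<omega> / \<sigma>y - \<rho> * (ex \<omega> / \<sigma>x)) / s) ^ j)
    (std_normal_moment i * std_normal_moment j)"
proof -
  define G where "G \<omega> = ex \<omega> / \<sigma>x" for \<omega>
  define H where "H \<omega> = (ey \<omega> / \<sigma>y - \<rho> * (ex \<omega> / \<sigma>x)) / s" for \<omega>
  let ?N = "density lborel std_normal_density"
  interpret N: prob_space ?N by (rule prob_space_normal_density) simp
  interpret NN: pair_prob_space ?N ?N ..
  have pair[measurable]: "(\<lambda>\<omega>. (ex \<omega>, ey \<omega>)) \<in> borel_measurable M"
    using distributed_measurable[OF D] by simp
  have [measurable]: "ex \<in> borel_measurable M" "ey \<in> borel_measurable M"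
    using measurable_compose[OF pair, of fst borel] measurable_compose[OF pair, of snd borel]
    by (simp_all add: borel_prod[symmetric])
  have [measurable]: "G \<in> borel_measurable M" "H \<in> borel_measurable M"
    unfolding G_def H_def by measurable
  have law: "distr M (borel \<Otimes>\<^sub>M borel) (\<lambda>\<omega>. (G \<omega>, H \<omega>)) = ?N \<Otimes>\<^sub>M ?N"
    using bivariate_normal_standardise[OF D pos] by (simp add: G_def H_def s_def)
  have "distr M borel G = distr (distr M (borel \<Otimes>\<^sub>M borel) (\<lambda>\<omega>. (G \<omega>, H \<omega>))) borel fst"
    by (subst distr_distr) (auto simp: comp_def)
  also have "\<dots> = distr (?N \<Otimes>\<^sub>M ?N) ?N fst"
    unfolding law by (rule distr_cong) auto
  also have "\<dots> = ?N" by (rule N.distr_pair_fst)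
  finally have G: "distr M borel G = ?N" .
  have "distr M borel H = distr (distr M (borel \<Otimes>\<^sub>M borel) (\<lambda>\<omega>. (G \<omega>, H \<omega>))) borel snd"
    by (subst distr_distr) (auto simp: comp_def)
  also have "\<dots> = distr (?N \<Otimes>\<^sub>M ?N) ?N snd"
    unfolding law by (rule distr_cong) auto
  also have "\<dots> = distr (distr (?N \<Otimes>\<^sub>M ?N) (?N \<Otimes>\<^sub>M ?N) (\<lambda>(x, y). (y, x))) ?N snd"
    by (subst NN.distr_pair_swap[symmetric]) simp
  also have "\<dots> = distr (?N \<Otimes>\<^sub>M ?N) ?N fst"
    by (subst distr_distr) (auto simp: comp_def case_prod_beta')
  also have "\<dots> = ?N" by (rule N.distr_pair_fst)
  finally have H: "distr M borel H = ?N" .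
  have ind: "indep_var borel G borel H"
    unfolding indep_var_distribution_eq G H law by simp
  have moment: "has_bochner_integral M (\<lambda>\<omega>. F \<omega> ^ k) (std_normal_moment k)"
    if F: "distr M borel F = ?N" and [measurable]: "F \<in> borel_measurable M" for F k
  proof -
    have "has_bochner_integral lborel (\<lambda>x. std_normal_density x * x ^ k) (std_normal_moment k)"
    proof (cases "even k")
      case True
      then obtain m where "k = 2 * m" by blast
      then show ?thesis using std_normal_moment_even[of m] by (simp add: std_normal_moment_def)
    next
      case False
      then obtain m where "k = 2 * m + 1" using oddE by blast
      then show ?thesis using std_normal_moment_odd[of m] by (simp add: std_normal_moment_def)
    qed
    then have "has_bochner_integral ?N (\<lambda>x. x ^ k) (std_normal_moment k)"
      by (subst has_bochner_integral_density) (auto simp: normal_density_nonneg)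
    then show ?thesis
      unfolding F[symmetric] has_bochner_integral_iff by (simp add: integrable_distr_eq integral_distr)
  qed
  have "indep_var borel ((\<lambda>x. x ^ i) \<circ> G) borel ((\<lambda>x. x ^ j) \<circ> H)"
    by (intro indep_var_compose[OF ind]) auto
  then have ind': "indep_var borel (\<lambda>\<omega>. G \<omega> ^ i) borel (\<lambda>\<omega>. H \<omega> ^ j)" by (simp add: comp_def)
  note mG = moment[OF G, of i] and mH = moment[OF H, of j]
  have "has_bochner_integral M (\<lambda>\<omega>. G \<omega> ^ i * H \<omega> ^ j) (std_normal_moment i * std_normal_moment j)"
    using indep_var_integrable[OF ind'] indep_var_lebesgue_integral[OF ind'] mG mH
    by (auto simp: has_bochner_integral_iff)
  then show ?thesis unfolding G_def H_def .
qed

section \<open>Independence\<close>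

text \<open>
  The independent variables may have different types as long as the functions of them share one,
  as \<open>indep_var\<close> demands.
\<close>

lemma (in prob_space) independent_rv_imp_indep_var:
  fixes A B :: "'d measure"
  assumes ind: "independent_rv M S U T V"
    and p: "p \<in> measurable S A" and q: "q \<in> measurable T B"
  shows "indep_var A (\<lambda>\<omega>. p (U \<omega>)) B (\<lambda>\<omega>. q (V \<omega>))"
proof -
  let ?E = "\<lambda>S U. {U -` A \<inter> space M | A. A \<in> sets S}"
  note ind = ind[unfolded independent_rv_def]
  have U: "U \<in> measurable M S" by (rule ind[THEN conjunct1])
  have V: "V \<in> measurable M T" by (rule ind[THEN conjunct2, THEN conjunct1])
  have ind': "indep_set (?E S U) (?E T V)" by (rule ind[THEN conjunct2, THEN conjunct2])
  have sub_p: "?E A (\<lambda>\<omega>. p (U \<omega>)) \<subseteq> ?E S U"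
  proof
    fix c assume "c \<in> ?E A (\<lambda>\<omega>. p (U \<omega>))"
    then obtain a where "a \<in> sets A" and c: "c = (\<lambda>\<omega>. p (U \<omega>)) -` a \<inter> space M" by blast
    have "c = U -` (p -` a \<inter> space S) \<inter> space M"
      unfolding c using measurable_space[OF U] by blast
    then show "c \<in> ?E S U" using measurable_sets[OF p \<open>a \<in> sets A\<close>] by blast
  qed
  have sub_q: "?E B (\<lambda>\<omega>. q (V \<omega>)) \<subseteq> ?E T V"
  proof
    fix c assume "c \<in> ?E B (\<lambda>\<omega>. q (V \<omega>))"
    then obtain b where "b \<in> sets B" and c: "c = (\<lambda>\<omega>. q (V \<omega>)) -` b \<inter> space M" by blast
    have "c = V -` (q -` b \<inter> space T) \<inter> space M"
      unfolding c using measurable_space[OF V] by blast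
    then show "c \<in> ?E T V" using measurable_sets[OF q \<open>b \<in> sets B\<close>] by blast
  qed
  have "indep_set (?E A (\<lambda>\<omega>. p (U \<omega>))) (?E B (\<lambda>\<omega>. q (V \<omega>)))"
  proof (rule indep_setI)
    have "?E S U \<subseteq> events" using measurable_sets[OF U] by blast
    then show "?E A (\<lambda>\<omega>. p (U \<omega>)) \<subseteq> events" using sub_p by (rule order_trans[rotated])
    have "?E T V \<subseteq> events" using measurable_sets[OF V] by blast
    then show "?E B (\<lambda>\<omega>. q (V \<omega>)) \<subseteq> events" using sub_q by (rule order_trans[rotated])
    show "prob (a \<inter> b) = prob a * prob b"
      if "a \<in> ?E A (\<lambda>\<omega>. p (U \<omega>))" "b \<in> ?E B (\<lambda>\<omega>. q (V \<omega>))" for a b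
      by (rule indep_setD[OF ind' subsetD[OF sub_p that(1)] subsetD[OF sub_q that(2)]])
  qed
  moreover have "Int_stable (?E C F)" for C :: "'d measure" and F :: "'a \<Rightarrow> 'd"
  proof (rule Int_stableI)
    fix a b assume "a \<in> ?E C F" "b \<in> ?E C F"
    then obtain a' b' where "a = F -` a' \<inter> space M" "a' \<in> sets C" "b = F -` b' \<inter> space M" "b' \<in> sets C"
      by blast
    then have "a \<inter> b = F -` (a' \<inter> b') \<inter> space M \<and> a' \<inter> b' \<in> sets C" by auto
    then show "a \<inter> b \<in> ?E C F" by blast
  qed
  ultimately have "indep_set (sigma_sets (space M) (?E A (\<lambda>\<omega>. p (U \<omega>))))
      (sigma_sets (space M) (?E B (\<lambda>\<omega>. q (V \<omega>))))"
    by (intro indep_set_sigma_sets)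
  then show ?thesis
    unfolding indep_var_eq using measurable_compose[OF U p] measurable_compose[OF V q] by simp
qed

text \<open>
  Mixed products have mean zero, so second moments add.
\<close>

lemma (in prob_space) sum_square_indep_centred:
  fixes \<xi> :: "'i \<Rightarrow> 'a \<Rightarrow> real"
  assumes "finite J" "indep_vars (\<lambda>_. borel) \<xi> J"
    and "\<And>i. i \<in> J \<Longrightarrow> integrable M (\<lambda>\<omega>. (\<xi> i \<omega>)\<^sup>2)"
    and "\<And>i. i \<in> J \<Longrightarrow> expectation (\<xi> i) = 0"
  shows "integrable M (\<lambda>\<omega>. (\<Sum>i\<in>J. \<xi> i \<omega>)\<^sup>2) \<and>
    expectation (\<lambda>\<omega>. (\<Sum>i\<in>J. \<xi> i \<omega>)\<^sup>2) = (\<Sum>i\<in>J. expectation (\<lambda>\<omega>. (\<xi> i \<omega>)\<^sup>2))"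
  using assms
proof (induction J)
  case empty
  then show ?case by simp
next
  case (insert i J)
  let ?S = "\<lambda>\<omega>. \<Sum>i\<in>J. \<xi> i \<omega>"
  have meas[measurable]: "\<xi> j \<in> borel_measurable M" if "j \<in> insert i J" for j
    using insert.prems(1) that unfolding indep_vars_def by auto
  have S[measurable]: "?S \<in> borel_measurable M" by (intro borel_measurable_sum meas) auto
  have IH: "integrable M (\<lambda>\<omega>. (?S \<omega>)\<^sup>2)"
    "expectation (\<lambda>\<omega>. (?S \<omega>)\<^sup>2) = (\<Sum>i\<in>J. expectation (\<lambda>\<omega>. (\<xi> i \<omega>)\<^sup>2))"
    using insert.IH insert.prems indep_vars_subset[OF insert.prems(1)] by auto
  have int: "integrable M (\<xi> i)" "integrable M ?S"
    using insert.prems(2) IH(1) meas by (auto intro: square_integrable_imp_integrable)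
  have ind: "indep_var borel (\<xi> i) borel ?S"
    using indep_vars_sum[OF insert.hyps insert.prems(1)] .
  have cross: "integrable M (\<lambda>\<omega>. \<xi> i \<omega> * ?S \<omega>)" "expectation (\<lambda>\<omega>. \<xi> i \<omega> * ?S \<omega>) = 0"
    using indep_var_integrable[OF ind int] indep_var_lebesgue_integral[OF ind int] insert.prems(3)[of i]
    by auto
  have eq: "(\<Sum>i\<in>insert i J. \<xi> i \<omega>)\<^sup>2 = (\<xi> i \<omega>)\<^sup>2 + 2 * (\<xi> i \<omega> * ?S \<omega>) + (?S \<omega>)\<^sup>2" for \<omega>
    using insert.hyps by (simp add: power2_sum algebra_simps)
  show ?case
    unfolding eq using insert.hyps insert.prems(2)[of i] IH cross by simp
qed

text \<open>
  Observations are counted from 1, the summands of the central limit theorem from 0.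
\<close>

lemma (in prob_space) indep_sets_reindex_Suc:
  assumes "indep_sets E {1 :: nat..}"
  shows "indep_sets (\<lambda>i. E (Suc i)) UNIV"
proof (rule indep_setsI)
  show "E (Suc i) \<subseteq> events" for i using assms by (auto simp: indep_sets_def)
  fix A and J :: "nat set" assume J: "J \<noteq> {}" "finite J" "\<forall>j\<in>J. A j \<in> E (Suc j)"
  have "prob (\<Inter>j\<in>Suc ` J. A (j - 1)) = (\<Prod>j\<in>Suc ` J. prob (A (j - 1)))"
    using J by (intro indep_setsD[OF assms]) auto
  then show "prob (\<Inter>j\<in>J. A j) = (\<Prod>j\<in>J. prob (A j))"
    by (simp add: prod.reindex image_image)
qed

section \<open>A sample from the additive noise model\<close>

locale ganm_sample = prob_space M for M :: "'a measure" +
  fixes X Y :: "nat \<Rightarrow> 'a \<Rightarrow> real"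
    and Z :: "nat \<Rightarrow> 'a \<Rightarrow> 'z :: euclidean_space"
    and fZ :: "'z \<Rightarrow> ennreal"
    and mx my :: "'z \<Rightarrow> real"
    and \<sigma>x \<sigma>y \<rho> :: real
  assumes sample: "iid M borel {1..} (\<lambda>i \<omega>. (X i \<omega>, Y i \<omega>, Z i \<omega>))"
    and model: "\<And>i. i \<ge> 1 \<Longrightarrow> GANM M (X i) (Y i) (Z i) fZ mx my \<sigma>x \<sigma>y \<rho>"
begin

definition W :: "nat \<Rightarrow> 'a \<Rightarrow> real \<times> real \<times> 'z" where
  "W i \<omega> = (X i \<omega>, Y i \<omega>, Z i \<omega>)"

definition PZ :: "'z measure" where
  "PZ = distr M borel (Z 1)"

text \<open>
  The standardised errors, as functions of an observation \<open>(x, y, z)\<close>.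
\<close>

definition \<xi> :: "real \<times> real \<times> 'z \<Rightarrow> real" where
  "\<xi> = (\<lambda>(x, y, z). (x - mx z) / \<sigma>x)"

definition \<eta> :: "real \<times> real \<times> 'z \<Rightarrow> real" where
  "\<eta> = (\<lambda>(x, y, z). (y - my z) / \<sigma>y)"

definition \<tau> :: real where
  "\<tau> = sqrt (1 - \<rho>\<^sup>2)"

text \<open>
  The part of \<open>\<eta>\<close> orthogonal to \<open>\<xi>\<close>, scaled to unit variance.
\<close>

definition \<zeta> :: "real \<times> real \<times> 'z \<Rightarrow> real" where
  "\<zeta> w = (\<eta> w - \<rho> * \<xi> w) / \<tau>"

text \<open>
  The influence function of the correlation coefficient.
\<close>

definition \<psi> :: "real \<times> real \<times> 'z \<Rightarrow> real" where
  "\<psi> w = \<xi> w * \<eta> w - \<rho> * ((\<xi> w)\<^sup>2 + (\<eta> w)\<^sup>2) / 2"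

lemma parameters:
  shows "0 < \<sigma>x" "0 < \<sigma>y" "- 1 < \<rho>" "\<rho> < 1" "0 < 1 - \<rho>\<^sup>2"
    and regression_measurable[measurable]: "mx \<in> borel_measurable borel" "my \<in> borel_measurable borel"
  using model[of 1] by (auto simp: GANM_def abs_square_less_1)

lemma indep_W: "indep_vars (\<lambda>_. borel) W {1..}"
  using sample unfolding iid_def W_def[abs_def] by (rule conjunct1)

lemma ident_W: "i \<ge> 1 \<Longrightarrow> distr M borel (W i) = distr M borel (W 1)"
  using sample[unfolded iid_def, THEN conjunct2, THEN bspec, THEN bspec, of i 1]
  by (simp only: W_def[abs_def] atLeast_iff order_refl)

lemma W_measurable: "i \<ge> 1 \<Longrightarrow> W i \<in> borel_measurable M"
  using indep_W unfolding indep_vars_def by auto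

lemma Z_projection_measurable[measurable]: "(\<lambda>w :: real \<times> real \<times> 'z. snd (snd w)) \<in> borel_measurable borel"
  by (simp flip: borel_prod)

lemma XYZ_measurable:
  assumes "i \<ge> 1"
  shows "X i \<in> borel_measurable M" "Y i \<in> borel_measurable M" "Z i \<in> borel_measurable M"
proof -
  have "(\<lambda>\<omega>. fst (W i \<omega>)) \<in> borel_measurable M" "(\<lambda>\<omega>. fst (snd (W i \<omega>))) \<in> borel_measurable M"
    "(\<lambda>\<omega>. snd (snd (W i \<omega>))) \<in> borel_measurable M"
    by (rule measurable_compose[OF W_measurable[OF assms]], simp flip: borel_prod)+
  then show "X i \<in> borel_measurable M" "Y i \<in> borel_measurable M" "Z i \<in> borel_measurable M"
    by (simp_all add: W_def)
qed

lemma error_measurable[measurable]: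
  "\<xi> \<in> borel_measurable borel" "\<eta> \<in> borel_measurable borel"
  "\<zeta> \<in> borel_measurable borel" "\<psi> \<in> borel_measurable borel"
proof -
  show \<xi>[measurable]: "\<xi> \<in> borel_measurable borel"
    unfolding \<xi>_def by (simp flip: borel_prod)
  show \<eta>[measurable]: "\<eta> \<in> borel_measurable borel"
    unfolding \<eta>_def by (simp flip: borel_prod)
  show "\<zeta> \<in> borel_measurable borel" unfolding \<zeta>_def[abs_def] by measurable
  show "\<psi> \<in> borel_measurable borel" unfolding \<psi>_def[abs_def] by measurable
qed

lemma distr_Z: 
  assumes "i \<ge> 1" shows "distr M borel (Z i) = PZ"
proof -
  have eq: "distr M borel (Z j) = density lborel fZ" if "j \<ge> 1" for j
  proof -
    have "distributed M lborel (Z j) fZ" using model[OF that] by (simp add: GANM_def)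
    then have "distr M lborel (Z j) = density lborel fZ" by (rule distributed_distr_eq_density)
    moreover have "distr M lborel (Z j) = distr M borel (Z j)" by (intro distr_cong) auto
    ultimately show ?thesis by simp
  qed
  show ?thesis unfolding PZ_def using eq[OF assms] eq[of 1] by simp
qed

text \<open>
  The model only asserts that suitable errors exist; their scaled versions agree with \<open>\<xi>\<close> and \<open>\<eta>\<close>
  evaluated at the observation, so that these inherit their law and their independence of \<open>Z\<close>.
\<close>

lemma error_law:
  assumes "i \<ge> 1"
  shows error_moments: "has_bochner_integral M (\<lambda>\<omega>. \<xi> (W i \<omega>) ^ a * \<zeta> (W i \<omega>) ^ b)
      (std_normal_moment a * std_normal_moment b)"
    and error_indep_Z: "\<phi> \<in> {\<xi>, \<eta>} \<Longrightarrow> g \<in> borel_measurable borel \<Longrightarrow>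
      indep_var borel (\<lambda>\<omega>. \<phi> (W i \<omega>)) borel (\<lambda>\<omega>. g (Z i \<omega>))"
proof -
  obtain ex ey where
    D: "distributed M lborel (\<lambda>\<omega>. (ex \<omega>, ey \<omega>)) (\<lambda>e. ennreal (bivariate_normal_density \<sigma>x \<sigma>y \<rho> e))"
    and ind: "independent_rv M borel (\<lambda>\<omega>. (ex \<omega>, ey \<omega>)) borel (Z i)"
    and XY: "\<And>\<omega>. \<omega> \<in> space M \<Longrightarrow> X i \<omega> = mx (Z i \<omega>) + ex \<omega>"
      "\<And>\<omega>. \<omega> \<in> space M \<Longrightarrow> Y i \<omega> = my (Z i \<omega>) + ey \<omega>"
    using model[OF assms] unfolding GANM_def by blast
  have err: "\<xi> (W i \<omega>) = ex \<omega> / \<sigma>x" "\<eta> (W i \<omega>) = ey \<omega> / \<sigma>y" if "\<omega> \<in> space M" for \<omega>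
    using XY[OF that] by (simp_all add: \<xi>_def \<eta>_def W_def)
  show "has_bochner_integral M (\<lambda>\<omega>. \<xi> (W i \<omega>) ^ a * \<zeta> (W i \<omega>) ^ b)
      (std_normal_moment a * std_normal_moment b)"
    using bivariate_normal_moments[OF D parameters(1-4), of a b]
    by (rule has_bochner_integral_cong[THEN iffD1, rotated -1]) (simp_all add: err \<zeta>_def \<tau>_def)
  assume \<phi>: "\<phi> \<in> {\<xi>, \<eta>}" and g: "g \<in> borel_measurable borel"
  define p where "p = (if \<phi> = \<xi> then (\<lambda>e. fst e / \<sigma>x) else (\<lambda>e :: real \<times> real. snd e / \<sigma>y))"
  have p: "p \<in> borel_measurable borel" unfolding p_def by (simp flip: borel_prod)
  have "indep_var borel (\<lambda>\<omega>. p (ex \<omega>, ey \<omega>)) borel (\<lambda>\<omega>. g (Z i \<omega>))"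
    by (rule independent_rv_imp_indep_var[OF ind p g])
  moreover have "p (ex \<omega>, ey \<omega>) = \<phi> (W i \<omega>)" if "\<omega> \<in> space M" for \<omega>
    using \<phi> err[OF that] by (auto simp: p_def)
  ultimately show "indep_var borel (\<lambda>\<omega>. \<phi> (W i \<omega>)) borel (\<lambda>\<omega>. g (Z i \<omega>))"
    unfolding indep_var_eq
    by (smt (verit, best) Collect_cong measurable_cong vimage_inter_cong)
qed

lemma \<tau>: "0 < \<tau>" "\<tau>\<^sup>2 = 1 - \<rho>\<^sup>2"
  using parameters(5) by (simp_all add: \<tau>_def)

lemma \<eta>_eq: "\<eta> w = \<rho> * \<xi> w + \<tau> * \<zeta> w"
  using \<tau>(1) by (simp add: \<zeta>_def)

lemma error_second_order:
  assumes "i \<ge> 1"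
  shows "has_bochner_integral M (\<lambda>\<omega>. \<xi> (W i \<omega>)) 0" "has_bochner_integral M (\<lambda>\<omega>. \<eta> (W i \<omega>)) 0"
    "has_bochner_integral M (\<lambda>\<omega>. (\<xi> (W i \<omega>))\<^sup>2) 1" "has_bochner_integral M (\<lambda>\<omega>. (\<eta> (W i \<omega>))\<^sup>2) 1"
    "has_bochner_integral M (\<lambda>\<omega>. \<xi> (W i \<omega>) * \<eta> (W i \<omega>)) \<rho>"
proof -
  note mom = error_moments[OF assms]
  note val = std_normal_moment_values
  have m10: "has_bochner_integral M (\<lambda>\<omega>. \<xi> (W i \<omega>)) 0"
    using mom[of 1 0, unfolded val] by simp
  have m01: "has_bochner_integral M (\<lambda>\<omega>. \<zeta> (W i \<omega>)) 0"
    using mom[of 0 1, unfolded val] by simp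
  have m20: "has_bochner_integral M (\<lambda>\<omega>. (\<xi> (W i \<omega>))\<^sup>2) 1"
    using mom[of 2 0, unfolded val] by simp
  have m02: "has_bochner_integral M (\<lambda>\<omega>. (\<zeta> (W i \<omega>))\<^sup>2) 1"
    using mom[of 0 2, unfolded val] by simp
  have m11: "has_bochner_integral M (\<lambda>\<omega>. \<xi> (W i \<omega>) * \<zeta> (W i \<omega>)) 0"
    using mom[of 1 1, unfolded val] by simp
  show "has_bochner_integral M (\<lambda>\<omega>. \<xi> (W i \<omega>)) 0" "has_bochner_integral M (\<lambda>\<omega>. (\<xi> (W i \<omega>))\<^sup>2) 1"
    by fact+
  show "has_bochner_integral M (\<lambda>\<omega>. \<eta> (W i \<omega>)) 0"
    unfolding \<eta>_eq
    using has_bochner_integral_add[OF has_bochner_integral_mult_right[OF m10, of \<rho>]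
        has_bochner_integral_mult_right[OF m01, of \<tau>]] by simp
  have "has_bochner_integral M (\<lambda>\<omega>. \<rho> * (\<xi> (W i \<omega>))\<^sup>2 + \<tau> * (\<xi> (W i \<omega>) * \<zeta> (W i \<omega>))) (\<rho> * 1 + \<tau> * 0)"
    by (intro has_bochner_integral_add has_bochner_integral_mult_right m20 m11)
  moreover have "\<rho> * (\<xi> w)\<^sup>2 + \<tau> * (\<xi> w * \<zeta> w) = \<xi> w * \<eta> w" for w
    unfolding \<eta>_eq by (simp add: algebra_simps power2_eq_square)
  ultimately show "has_bochner_integral M (\<lambda>\<omega>. \<xi> (W i \<omega>) * \<eta> (W i \<omega>)) \<rho>" by simp
  have "has_bochner_integral M (\<lambda>\<omega>. \<rho>\<^sup>2 * (\<xi> (W i \<omega>))\<^sup>2 + 2 * \<rho> * \<tau> * (\<xi> (W i \<omega>) * \<zeta> (W i \<omega>)) + \<tau>\<^sup>2 * (\<zeta> (W i \<omega>))\<^sup>2)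
      (\<rho>\<^sup>2 * 1 + 2 * \<rho> * \<tau> * 0 + \<tau>\<^sup>2 * 1)"
    by (intro has_bochner_integral_add has_bochner_integral_mult_right m20 m11 m02)
  moreover have "\<rho>\<^sup>2 * (\<xi> w)\<^sup>2 + 2 * \<rho> * \<tau> * (\<xi> w * \<zeta> w) + \<tau>\<^sup>2 * (\<zeta> w)\<^sup>2 = (\<eta> w)\<^sup>2" for w
    unfolding \<eta>_eq by (simp add: algebra_simps power2_eq_square)
  moreover have "\<rho>\<^sup>2 * 1 + 2 * \<rho> * \<tau> * 0 + \<tau>\<^sup>2 * 1 = 1" by (simp add: \<tau>(2))
  ultimately show "has_bochner_integral M (\<lambda>\<omega>. (\<eta> (W i \<omega>))\<^sup>2) 1" by simp
qed

text \<open>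
  In terms of the independent standard normal variables \<open>\<xi>\<close> and \<open>\<zeta>\<close>,
  \<open>\<psi> = \<rho> * \<tau>\<^sup>2 / 2 * (\<xi>\<^sup>2 - \<zeta>\<^sup>2) + \<tau>\<^sup>3 * \<xi> * \<zeta>\<close>. The two summands are uncorrelated, with second
  moments \<open>\<rho>\<^sup>2 * \<tau>\<^sup>4\<close> and \<open>\<tau>\<^sup>6\<close>.
\<close>

lemma influence_moments:
  assumes "i \<ge> 1"
  shows "has_bochner_integral M (\<lambda>\<omega>. \<psi> (W i \<omega>)) 0"
    "has_bochner_integral M (\<lambda>\<omega>. (\<psi> (W i \<omega>))\<^sup>2) ((1 - \<rho>\<^sup>2)\<^sup>2)"
proof -
  have "has_bochner_integral M (\<lambda>\<omega>. \<xi> (W i \<omega>) * \<eta> (W i \<omega>) - \<rho> / 2 * ((\<xi> (W i \<omega>))\<^sup>2 + (\<eta> (W i \<omega>))\<^sup>2))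
     (\<rho> - \<rho> / 2 * (1 + 1))"
    by (intro has_bochner_integral_diff has_bochner_integral_add has_bochner_integral_mult_right
        error_second_order assms)
  then show "has_bochner_integral M (\<lambda>\<omega>. \<psi> (W i \<omega>)) 0" by (simp add: \<psi>_def)
  have \<psi>_eq: "\<psi> w = \<rho> * \<tau>\<^sup>2 / 2 * ((\<xi> w)\<^sup>2 - (\<zeta> w)\<^sup>2) + \<tau> ^ 3 * (\<xi> w * \<zeta> w)" for w
  proof -
    have "\<psi> w = \<rho> * (1 - \<rho>\<^sup>2) / 2 * (\<xi> w)\<^sup>2 - \<rho> * \<tau>\<^sup>2 / 2 * (\<zeta> w)\<^sup>2 + \<tau> * (1 - \<rho>\<^sup>2) * (\<xi> w * \<zeta> w)"
      unfolding \<psi>_def \<eta>_eq by (simp add: field_simps power2_eq_square)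
    also have "\<dots> = \<rho> * \<tau>\<^sup>2 / 2 * ((\<xi> w)\<^sup>2 - (\<zeta> w)\<^sup>2) + \<tau> ^ 3 * (\<xi> w * \<zeta> w)"
      unfolding \<tau>(2)[symmetric] by (simp add: field_simps power2_eq_square power3_eq_cube)
    finally show ?thesis .
  qed
  let ?m = "\<lambda>a b \<omega>. \<xi> (W i \<omega>) ^ a * \<zeta> (W i \<omega>) ^ b"
  let ?\<mu> = "\<lambda>a b. std_normal_moment a * std_normal_moment b"
  have "has_bochner_integral M
     (\<lambda>\<omega>. \<rho>\<^sup>2 * \<tau> ^ 4 / 4 * (?m 4 0 \<omega> - 2 * ?m 2 2 \<omega> + ?m 0 4 \<omega>) +
        \<rho> * \<tau> ^ 5 * (?m 3 1 \<omega> - ?m 1 3 \<omega>) + \<tau> ^ 6 * ?m 2 2 \<omega>)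
     (\<rho>\<^sup>2 * \<tau> ^ 4 / 4 * (?\<mu> 4 0 - 2 * ?\<mu> 2 2 + ?\<mu> 0 4) +
        \<rho> * \<tau> ^ 5 * (?\<mu> 3 1 - ?\<mu> 1 3) + \<tau> ^ 6 * ?\<mu> 2 2)"
    by (intro has_bochner_integral_diff has_bochner_integral_add has_bochner_integral_mult_right
        error_moments assms)
  moreover have "\<rho>\<^sup>2 * \<tau> ^ 4 / 4 * (?m 4 0 \<omega> - 2 * ?m 2 2 \<omega> + ?m 0 4 \<omega>) +
        \<rho> * \<tau> ^ 5 * (?m 3 1 \<omega> - ?m 1 3 \<omega>) + \<tau> ^ 6 * ?m 2 2 \<omega> = (\<psi> (W i \<omega>))\<^sup>2" for \<omega>
    unfolding \<psi>_eq by (simp add: field_simps power2_eq_square numeral_eq_Suc)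
  moreover have "\<rho>\<^sup>2 * \<tau> ^ 4 / 4 * (?\<mu> 4 0 - 2 * ?\<mu> 2 2 + ?\<mu> 0 4) +
        \<rho> * \<tau> ^ 5 * (?\<mu> 3 1 - ?\<mu> 1 3) + \<tau> ^ 6 * ?\<mu> 2 2 = (1 - \<rho>\<^sup>2)\<^sup>2"
  proof -
    have "\<rho>\<^sup>2 * (\<tau>\<^sup>2)\<^sup>2 + (\<tau>\<^sup>2) ^ 3 = (1 - \<rho>\<^sup>2)\<^sup>2"
      unfolding \<tau>(2) by (simp add: algebra_simps power2_eq_square power3_eq_cube)
    then have "\<rho>\<^sup>2 * \<tau> ^ 4 + \<tau> ^ 6 = (1 - \<rho>\<^sup>2)\<^sup>2"
      by (simp flip: power_mult)
    then show ?thesis by (simp only: std_normal_moment_values) simp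
  qed
  ultimately show "has_bochner_integral M (\<lambda>\<omega>. (\<psi> (W i \<omega>))\<^sup>2) ((1 - \<rho>\<^sup>2)\<^sup>2)" by simp
qed

text \<open>
  These make the empirical second moments of the errors converge at the rate \<open>1 / sqrt n\<close>.
\<close>

lemma error_fourth_order:
  assumes "i \<ge> 1"
  shows "integrable M (\<lambda>\<omega>. ((\<xi> (W i \<omega>))\<^sup>2 - 1)\<^sup>2)" "integrable M (\<lambda>\<omega>. ((\<eta> (W i \<omega>))\<^sup>2 - 1)\<^sup>2)"
    "integrable M (\<lambda>\<omega>. (\<xi> (W i \<omega>) * \<eta> (W i \<omega>) - \<rho>)\<^sup>2)"
proof -
  have m: "integrable M (\<lambda>\<omega>. \<xi> (W i \<omega>) ^ a * \<zeta> (W i \<omega>) ^ b)" for a b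
    using error_moments[OF assms, of a b] by (simp add: has_bochner_integral_iff)
  have [measurable]: "W i \<in> borel_measurable M" using W_measurable[OF assms] .
  have x4: "integrable M (\<lambda>\<omega>. (\<xi> (W i \<omega>))^4)" using m[of 4 0] by simp
  have z4: "integrable M (\<lambda>\<omega>. (\<zeta> (W i \<omega>))^4)" using m[of 0 4] by simp
  \<comment> \<open>convexity of the fourth power avoids expanding \<open>\<eta>\<close>\<close>
  have pow4: "(a + b) ^ 4 \<le> 8 * (a ^ 4 + b ^ 4)" for a b :: real
  proof -
    have "(a + b)\<^sup>2 \<le> 2 * (a\<^sup>2 + b\<^sup>2)" using sum_squares_bound[of a b] by (simp add: power2_sum)
    then have "((a + b)\<^sup>2)\<^sup>2 \<le> (2 * (a\<^sup>2 + b\<^sup>2))\<^sup>2" by (intro power_mono) auto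
    also have "\<dots> \<le> 8 * ((a\<^sup>2)\<^sup>2 + (b\<^sup>2)\<^sup>2)"
      using sum_squares_bound[of "a\<^sup>2" "b\<^sup>2"] by (simp add: power2_sum power_mult_distrib)
    finally show ?thesis by (simp flip: power_mult)
  qed
  have e4: "integrable M (\<lambda>\<omega>. (\<eta> (W i \<omega>))^4)"
  proof (rule Bochner_Integration.integrable_bound)
    show "integrable M (\<lambda>\<omega>. 8 * (\<rho> ^ 4 * (\<xi> (W i \<omega>))^4 + \<tau> ^ 4 * (\<zeta> (W i \<omega>))^4))"
      using x4 z4 by auto
    show "AE \<omega> in M. norm ((\<eta> (W i \<omega>))^4) \<le> norm (8 * (\<rho> ^ 4 * (\<xi> (W i \<omega>))^4 + \<tau> ^ 4 * (\<zeta> (W i \<omega>))^4))"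
      unfolding \<eta>_eq
      using pow4[of "\<rho> * \<xi> (W i _)" "\<tau> * \<zeta> (W i _)"]
      by (intro AE_I2) (simp add: power_mult_distrib)
  qed measurable
  have bound: "(u - c)\<^sup>2 \<le> 2 * u\<^sup>2 + 2 * c\<^sup>2" for u c :: real
    using zero_le_power2[of "u + c"] by (simp add: power2_sum power2_diff)
  show "integrable M (\<lambda>\<omega>. ((\<xi> (W i \<omega>))\<^sup>2 - 1)\<^sup>2)"
  proof (rule Bochner_Integration.integrable_bound)
    show "integrable M (\<lambda>\<omega>. 2 * (\<xi> (W i \<omega>))^4 + 2)" using x4 by auto
  qed (use bound[of "(\<xi> (W i _))\<^sup>2" 1] in \<open>auto simp flip: power_mult\<close>)
  show "integrable M (\<lambda>\<omega>. ((\<eta> (W i \<omega>))\<^sup>2 - 1)\<^sup>2)"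
  proof (rule Bochner_Integration.integrable_bound)
    show "integrable M (\<lambda>\<omega>. 2 * (\<eta> (W i \<omega>))^4 + 2)" using e4 by auto
  qed (use bound[of "(\<eta> (W i _))\<^sup>2" 1] in \<open>auto simp flip: power_mult\<close>)
  show "integrable M (\<lambda>\<omega>. (\<xi> (W i \<omega>) * \<eta> (W i \<omega>) - \<rho>)\<^sup>2)"
  proof (rule Bochner_Integration.integrable_bound)
    show "integrable M (\<lambda>\<omega>. (\<xi> (W i \<omega>))^4 + (\<eta> (W i \<omega>))^4 + 2 * \<rho>\<^sup>2)" using x4 e4 by auto
    have "(a * b - \<rho>)\<^sup>2 \<le> a ^ 4 + b ^ 4 + 2 * \<rho>\<^sup>2" for a b :: real
      using bound[of "a * b" \<rho>] sum_squares_bound[of "a\<^sup>2" "b\<^sup>2"]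
      by (simp add: power_mult_distrib flip: power_mult)
    then show "AE \<omega> in M. norm ((\<xi> (W i \<omega>) * \<eta> (W i \<omega>) - \<rho>)\<^sup>2)
        \<le> norm ((\<xi> (W i \<omega>))^4 + (\<eta> (W i \<omega>))^4 + 2 * \<rho>\<^sup>2)"
      by (intro AE_I2) (simp add: abs_of_nonneg)
  qed measurable
qed

lemma indep_function_of_W:
  assumes "h \<in> borel_measurable borel" "J \<subseteq> {1..}"
  shows "indep_vars (\<lambda>_. borel) (\<lambda>i \<omega>. h (W i \<omega>)) J"
  using indep_vars_compose2[OF indep_vars_subset[OF indep_W assms(2)], of "\<lambda>_. h"] assms(1) by simp

lemma expectation_function_of_W:
  fixes h :: "real \<times> real \<times> 'z \<Rightarrow> real"
  assumes [measurable]: "h \<in> borel_measurable borel" and i: "i \<ge> 1"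
  shows "expectation (\<lambda>\<omega>. h (W i \<omega>)) = expectation (\<lambda>\<omega>. h (W 1 \<omega>))"
proof -
  have [measurable]: "W i \<in> borel_measurable M" "W 1 \<in> borel_measurable M"
    using W_measurable i by auto
  have "expectation (\<lambda>\<omega>. h (W i \<omega>)) = (\<integral>w. h w \<partial>distr M borel (W i))"
    by (rule integral_distr[symmetric]) measurable
  also have "\<dots> = (\<integral>w. h w \<partial>distr M borel (W 1))" by (simp only: ident_W[OF i])
  also have "\<dots> = expectation (\<lambda>\<omega>. h (W 1 \<omega>))" by (rule integral_distr) measurable
  finally show ?thesis .
qed

text \<open>
  The denominator is \<open>n\<close> to the power \<open>3/4\<close>, while the sum has standard deviation of order
  \<open>sqrt n\<close>. Averages thus vanish even after multiplication by the fourth root of \<open>n\<close>, the scale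
  \<open>q\<close> at which the correlation is linearised.
\<close>

lemma centred_sum_rate:
  assumes h[measurable]: "h \<in> borel_measurable borel"
    and mean: "\<And>i. i \<ge> 1 \<Longrightarrow> has_bochner_integral M (\<lambda>\<omega>. h (W i \<omega>)) 0"
    and sq: "\<And>i. i \<ge> 1 \<Longrightarrow> integrable M (\<lambda>\<omega>. (h (W i \<omega>))\<^sup>2)"
    and J: "\<And>n. n \<ge> 1 \<Longrightarrow> J n \<subseteq> {1..} \<and> finite (J n) \<and> card (J n) = n"
  shows "((\<lambda>(n, \<omega>). (\<Sum>i\<in>J n. h (W i \<omega>)) / sqrt (sqrt (real n)) ^ 3) \<longlongrightarrow> 0) (in_prob M)"
proof -
  define v where "v = expectation (\<lambda>\<omega>. (h (W 1 \<omega>))\<^sup>2)"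
  have "((\<lambda>(n, \<omega>). ennreal (((\<Sum>i\<in>J n. h (W i \<omega>)) / sqrt (sqrt (real n)) ^ 3)\<^sup>2)) \<longlongrightarrow> 0) (in_prob M)"
  proof (rule Markov_in_prob)
    have m: "(\<lambda>\<omega>. \<Sum>i\<in>J n. h (W i \<omega>)) \<in> borel_measurable M" if "n \<ge> 1" for n
      using J[OF that] W_measurable
      by (intro borel_measurable_sum measurable_compose[OF _ h]) auto
    show "\<forall>\<^sub>F n in sequentially. (\<lambda>\<omega>. ennreal (((\<Sum>i\<in>J n. h (W i \<omega>)) / sqrt (sqrt (real n)) ^ 3)\<^sup>2)) \<in> borel_measurable M"
      using eventually_ge_at_top[of 1]
    proof eventually_elim
      case (elim n)
      note [measurable] = m[OF elim]
      show ?case by measurable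
    qed
    have "\<forall>\<^sub>F n in sequentially. ennreal (v / sqrt (real n)) =
        (\<integral>\<^sup>+\<omega>. ennreal (((\<Sum>i\<in>J n. h (W i \<omega>)) / sqrt (sqrt (real n)) ^ 3)\<^sup>2) \<partial>M)"
      using eventually_ge_at_top[of 1]
    proof eventually_elim
      case (elim n)
      have Jn: "J n \<subseteq> {1..}" "finite (J n)" "card (J n) = n" using J[OF elim] by auto
      let ?c = "(sqrt (sqrt (real n)) ^ 3)\<^sup>2"
      \<comment> \<open>so the squared denominator is the third power of \<open>sqrt n\<close>\<close>
      have "(x ^ 3)\<^sup>2 = (x\<^sup>2) ^ 3" for x :: real by (simp flip: power_mult)
      then have "?c = ((sqrt (sqrt (real n)))\<^sup>2) ^ 3" .
      also have "\<dots> = real n * sqrt (real n)" by (simp add: power3_eq_cube)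
      finally have c: "?c = real n * sqrt (real n)" .
      have S: "integrable M (\<lambda>\<omega>. (\<Sum>i\<in>J n. h (W i \<omega>))\<^sup>2)"
        "expectation (\<lambda>\<omega>. (\<Sum>i\<in>J n. h (W i \<omega>))\<^sup>2) = (\<Sum>i\<in>J n. expectation (\<lambda>\<omega>. (h (W i \<omega>))\<^sup>2))"
        using sum_square_indep_centred[OF Jn(2) indep_function_of_W[OF h Jn(1)]] Jn(1) sq mean
        by (auto simp: has_bochner_integral_iff subset_iff)
      have "(\<Sum>i\<in>J n. expectation (\<lambda>\<omega>. (h (W i \<omega>))\<^sup>2)) = (\<Sum>i\<in>J n. v)"
        unfolding v_def using Jn(1)
        by (intro sum.cong refl expectation_function_of_W[of "\<lambda>w. (h w)\<^sup>2"]) auto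
      then have S2: "expectation (\<lambda>\<omega>. (\<Sum>i\<in>J n. h (W i \<omega>))\<^sup>2) = real n * v" using S(2) Jn(3) by simp
      have "(\<integral>\<^sup>+\<omega>. ennreal (((\<Sum>i\<in>J n. h (W i \<omega>)) / sqrt (sqrt (real n)) ^ 3)\<^sup>2) \<partial>M) =
          (\<integral>\<^sup>+\<omega>. ennreal ((\<Sum>i\<in>J n. h (W i \<omega>))\<^sup>2 / ?c) \<partial>M)"
        by (simp add: power_divide)
      also have "\<dots> = ennreal (expectation (\<lambda>\<omega>. (\<Sum>i\<in>J n. h (W i \<omega>))\<^sup>2 / ?c))"
        using S(1) by (intro nn_integral_eq_integral) auto
      also have "expectation (\<lambda>\<omega>. (\<Sum>i\<in>J n. h (W i \<omega>))\<^sup>2 / ?c) = v / sqrt (real n)"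
        using S2 elim unfolding c by simp
      finally show ?case by simp
    qed
    moreover have "(\<lambda>n. v / sqrt (real n)) \<longlonglongrightarrow> 0"
      by (intro tendsto_divide_0[OF tendsto_const] filterlim_at_top_imp_at_infinity
          filterlim_compose[OF sqrt_at_top filterlim_real_sequentially])
    then have "(\<lambda>n. ennreal (v / sqrt (real n))) \<longlonglongrightarrow> 0"
      using tendsto_ennrealI by fastforce
    ultimately show "(\<lambda>n. \<integral>\<^sup>+\<omega>. ennreal (((\<Sum>i\<in>J n. h (W i \<omega>)) / sqrt (sqrt (real n)) ^ 3)\<^sup>2) \<partial>M) \<longlonglongrightarrow> 0"
      by (rule Lim_transform_eventually[rotated])
  qed
  then have "((\<lambda>x. ennreal ((case x of (n, \<omega>) \<Rightarrow> (\<Sum>i\<in>J n. h (W i \<omega>)) / sqrt (sqrt (real n)) ^ 3)\<^sup>2)) \<longlongrightarrow> 0) (in_prob M)"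
    by (simp add: case_prod_beta')
  then show ?thesis by (rule tendsto_zero_of_ennreal_square)
qed

lemma nn_integral_Z:
  assumes [measurable]: "f \<in> borel_measurable borel" and i: "i \<ge> 1"
  shows "(\<integral>\<^sup>+\<omega>. f (Z i \<omega>) \<partial>M) = (\<integral>\<^sup>+z. f z \<partial>PZ)"
proof -
  have [measurable]: "Z i \<in> borel_measurable M" using XYZ_measurable i by auto
  show ?thesis unfolding distr_Z[OF i, symmetric] by (simp add: nn_integral_distr)
qed

lemma sum_squares_expectation:
  assumes g[measurable]: "g \<in> borel_measurable borel" and J: "finite J" "J \<subseteq> {1..}"
  shows "(\<integral>\<^sup>+\<omega>. ennreal (\<Sum>i\<in>J. (g (Z i \<omega>))\<^sup>2) \<partial>M) = of_nat (card J) * (\<integral>\<^sup>+z. ennreal ((g z)\<^sup>2) \<partial>PZ)"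
proof -
  have [measurable]: "Z i \<in> borel_measurable M" if "i \<in> J" for i using XYZ_measurable that J(2) by auto
  have "(\<integral>\<^sup>+\<omega>. ennreal (\<Sum>i\<in>J. (g (Z i \<omega>))\<^sup>2) \<partial>M) = (\<integral>\<^sup>+\<omega>. (\<Sum>i\<in>J. ennreal ((g (Z i \<omega>))\<^sup>2)) \<partial>M)"
    by (simp add: sum_ennreal)
  also have "\<dots> = (\<Sum>i\<in>J. \<integral>\<^sup>+\<omega>. ennreal ((g (Z i \<omega>))\<^sup>2) \<partial>M)"
    by (rule nn_integral_sum) simp
  also have "\<dots> = (\<Sum>i\<in>J. \<integral>\<^sup>+z. ennreal ((g z)\<^sup>2) \<partial>PZ)"
    using J(2) by (intro sum.cong refl nn_integral_Z[of "\<lambda>z. ennreal ((g z)\<^sup>2)"]) auto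
  finally show ?thesis by simp
qed

text \<open>
  Given \<open>Z\<close> the error is still centred with unit variance, so each product has mean zero and
  second moment \<open>\<parallel>g\<parallel>\<^sup>2\<close>, and the products are independent across observations. For \<open>\<parallel>g\<parallel> = \<infinity>\<close> the
  bound is infinite, unless \<open>J\<close> is empty.
\<close>

lemma error_sum_expectation:
  assumes g[measurable]: "g \<in> borel_measurable borel" and J: "finite J" "J \<subseteq> {1..}"
    and \<phi>: "\<phi> \<in> {\<xi>, \<eta>}"
  shows "(\<integral>\<^sup>+\<omega>. ennreal ((\<Sum>i\<in>J. \<phi> (W i \<omega>) * g (Z i \<omega>))\<^sup>2) \<partial>M)
    \<le> of_nat (card J) * (\<integral>\<^sup>+z. ennreal ((g z)\<^sup>2) \<partial>PZ)"
proof (cases "J = {} \<or> (\<integral>\<^sup>+z. ennreal ((g z)\<^sup>2) \<partial>PZ) = \<top>")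
  case True
  then show ?thesis using J(1) by (auto simp: ennreal_mult_top)
next
  case False
  let ?K = "\<integral>\<^sup>+z. ennreal ((g z)\<^sup>2) \<partial>PZ"
  have \<phi>m[measurable]: "\<phi> \<in> borel_measurable borel" using \<phi> by auto
  have i1: "i \<ge> 1" if "i \<in> J" for i using that J(2) by auto
  have Zm: "Z i \<in> borel_measurable M" if "i \<in> J" for i using XYZ_measurable i1[OF that] by auto
  have Wm: "W i \<in> borel_measurable M" if "i \<in> J" for i using W_measurable i1[OF that] by auto
  have gsq: "integrable M (\<lambda>\<omega>. (g (Z i \<omega>))\<^sup>2)" "expectation (\<lambda>\<omega>. (g (Z i \<omega>))\<^sup>2) = enn2real ?K"
    if i: "i \<in> J" for i
  proof -
    note [measurable] = Zm[OF i]
    have eq: "(\<integral>\<^sup>+\<omega>. ennreal ((g (Z i \<omega>))\<^sup>2) \<partial>M) = ?K"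
      using nn_integral_Z[of "\<lambda>z. ennreal ((g z)\<^sup>2)", OF _ i1[OF i]] by simp
    then show "integrable M (\<lambda>\<omega>. (g (Z i \<omega>))\<^sup>2)"
      using False by (intro integrableI_nonneg) (auto simp: less_top)
    show "expectation (\<lambda>\<omega>. (g (Z i \<omega>))\<^sup>2) = enn2real ?K"
      unfolding eq[symmetric] by (rule integral_eq_nn_integral) auto
  qed
  have \<phi>1: "has_bochner_integral M (\<lambda>\<omega>. \<phi> (W i \<omega>)) 0" "has_bochner_integral M (\<lambda>\<omega>. (\<phi> (W i \<omega>))\<^sup>2) 1"
    if "i \<in> J" for i
    using error_second_order[OF i1[OF that]] \<phi> by auto
  define f where "f i \<omega> = \<phi> (W i \<omega>) * g (Z i \<omega>)" for i \<omega>
  have f: "integrable M (\<lambda>\<omega>. (f i \<omega>)\<^sup>2)" "expectation (\<lambda>\<omega>. (f i \<omega>)\<^sup>2) = enn2real ?K" "expectation (f i) = 0"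
    if i: "i \<in> J" for i
  proof -
    note [measurable] = Zm[OF i] Wm[OF i]
    have ind: "indep_var borel (\<lambda>\<omega>. \<phi> (W i \<omega>)) borel (\<lambda>\<omega>. g (Z i \<omega>))"
      by (rule error_indep_Z[OF i1[OF i] \<phi> g])
    have gint: "integrable M (\<lambda>\<omega>. g (Z i \<omega>))"
      by (rule square_integrable_imp_integrable[OF _ gsq(1)[OF i]]) measurable
    show "expectation (f i) = 0"
      using indep_var_lebesgue_integral[OF ind _ gint] \<phi>1(1)[OF i]
      by (simp add: f_def[abs_def] has_bochner_integral_iff)
    have "indep_var borel ((\<lambda>x. x\<^sup>2) \<circ> (\<lambda>\<omega>. \<phi> (W i \<omega>))) borel ((\<lambda>x. x\<^sup>2) \<circ> (\<lambda>\<omega>. g (Z i \<omega>)))"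
      by (intro indep_var_compose[OF ind]) auto
    then have ind2: "indep_var borel (\<lambda>\<omega>. (\<phi> (W i \<omega>))\<^sup>2) borel (\<lambda>\<omega>. (g (Z i \<omega>))\<^sup>2)"
      by (simp add: comp_def)
    show "integrable M (\<lambda>\<omega>. (f i \<omega>)\<^sup>2)" "expectation (\<lambda>\<omega>. (f i \<omega>)\<^sup>2) = enn2real ?K"
      using indep_var_integrable[OF ind2 _ gsq(1)[OF i]] indep_var_lebesgue_integral[OF ind2 _ gsq(1)[OF i]]
        \<phi>1(2)[OF i] gsq(2)[OF i]
      by (simp_all add: f_def power_mult_distrib has_bochner_integral_iff)
  qed
  have h[measurable]: "(\<lambda>w. \<phi> w * g (snd (snd w))) \<in> borel_measurable borel"
    by measurable
  have "indep_vars (\<lambda>_. borel) f J"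
    using indep_function_of_W[OF h J(2)] by (simp add: f_def[abs_def] W_def)
  from sum_square_indep_centred[OF J(1) this f(1) f(3)]
  have S: "integrable M (\<lambda>\<omega>. (\<Sum>i\<in>J. f i \<omega>)\<^sup>2)"
    "expectation (\<lambda>\<omega>. (\<Sum>i\<in>J. f i \<omega>)\<^sup>2) = real (card J) * enn2real ?K"
    using f(2) by auto
  have "(\<integral>\<^sup>+\<omega>. ennreal ((\<Sum>i\<in>J. f i \<omega>)\<^sup>2) \<partial>M) = ennreal (real (card J) * enn2real ?K)"
    unfolding S(2)[symmetric] using S(1) by (intro nn_integral_eq_integral) auto
  also have "\<dots> = of_nat (card J) * ?K"
    using False by (simp add: ennreal_mult' ennreal_of_nat_eq_real_of_nat less_top)
  finally show ?thesis by (simp add: f_def)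
qed

end

section \<open>Residuals on one half with regressions fitted on the other\<close>

lemma L2_norm_le_imp:
  assumes "L2_norm P g \<le> ennreal c" "0 \<le> c"
  shows "(\<integral>\<^sup>+z. ennreal ((g z)\<^sup>2) \<partial>P) \<le> ennreal (c\<^sup>2)"
proof -
  define I where "I = (\<integral>\<^sup>+z. ennreal ((g z)\<^sup>2) \<partial>P)"
  have fin: "I \<noteq> \<infinity>"
    using assms by (auto simp: L2_norm_def I_def[symmetric] Let_def top_unique split: if_splits)
  then have "ennreal (sqrt (enn2real I)) \<le> ennreal c"
    using assms by (simp add: L2_norm_def I_def[symmetric] Let_def)
  then have "sqrt (enn2real I) \<le> c" using assms by simp
  then have "(sqrt (enn2real I))\<^sup>2 \<le> c\<^sup>2" by (intro power_mono) auto
  then have "ennreal (enn2real I) \<le> ennreal (c\<^sup>2)" by (intro ennreal_leI) simp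
  moreover have "ennreal (enn2real I) = I" using fin by (simp add: less_top)
  ultimately show ?thesis unfolding I_def by metis
qed

text \<open>
  Regressions are fitted on the observations in \<open>I n\<close> and residuals are formed on those in \<open>J n\<close>.
  Cross-fitting uses two halves of the sample in both orders.
\<close>

locale sample_split = ganm_sample M X Y Z fZ mx my \<sigma>x \<sigma>y \<rho>
  for M :: "'a measure" and X Y and Z :: "nat \<Rightarrow> 'a \<Rightarrow> 'z :: euclidean_space"
    and fZ mx my \<sigma>x \<sigma>y \<rho> +
  fixes I J :: "nat \<Rightarrow> nat set"
  assumes split: "\<And>n. n \<ge> 1 \<Longrightarrow> I n \<subseteq> {1..} \<and> J n \<subseteq> {1..} \<and> I n \<inter> J n = {} \<and> finite (J n) \<and> card (J n) = n"
begin

definition train :: "nat \<Rightarrow> 'a \<Rightarrow> nat \<Rightarrow> real \<times> real \<times> 'z" where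
  "train n \<omega> = (\<lambda>i\<in>I n. W i \<omega>)"

definition test :: "nat \<Rightarrow> 'a \<Rightarrow> nat \<Rightarrow> real \<times> real \<times> 'z" where
  "test n \<omega> = (\<lambda>i\<in>J n. W i \<omega>)"

text \<open>
  The squared \<open>L\<^sub>2\<close> norm of the random function \<open>g n (train n \<omega>)\<close> is of smaller order than
  \<open>1 / sqrt n\<close> in probability. It is an extended real, since the norm may be infinite on a small
  event.
\<close>

definition negligible_error :: "(nat \<Rightarrow> (nat \<Rightarrow> real \<times> real \<times> 'z) \<Rightarrow> 'z \<Rightarrow> real) \<Rightarrow> bool" where
  "negligible_error g \<longleftrightarrow>
     (\<forall>n\<ge>1. (\<lambda>(d, z). g n d z) \<in> borel_measurable ((\<Pi>\<^sub>M i\<in>I n. borel) \<Otimes>\<^sub>M borel)) \<and>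
     ((\<lambda>(n, \<omega>). ennreal (sqrt (real n)) * (\<integral>\<^sup>+z. ennreal ((g n (train n \<omega>) z)\<^sup>2) \<partial>PZ)) \<longlongrightarrow> 0) (in_prob M)"

lemma train_space: "train n \<omega> \<in> space (\<Pi>\<^sub>M i\<in>I n. borel)"
  by (simp add: train_def space_PiM)

text \<open>
  The training and the test data are independent, so a statistic vanishes in probability as soon
  as its mean over the test data, for every fixed value of the training data, is bounded by a
  quantity that vanishes.
\<close>

lemma conditional_vanishing:
  fixes h :: "nat \<Rightarrow> (nat \<Rightarrow> real \<times> real \<times> 'z) \<times> (nat \<Rightarrow> real \<times> real \<times> 'z) \<Rightarrow> ennreal"
  assumes g: "negligible_error g"
    and h: "\<And>n. n \<ge> 1 \<Longrightarrow> h n \<in> borel_measurable ((\<Pi>\<^sub>M i\<in>I n. borel) \<Otimes>\<^sub>M (\<Pi>\<^sub>M i\<in>J n. borel))"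
    and bound: "\<And>n d. n \<ge> 1 \<Longrightarrow> d \<in> space (\<Pi>\<^sub>M i\<in>I n. borel) \<Longrightarrow>
      (\<integral>\<^sup>+\<omega>. h n (d, test n \<omega>) \<partial>M) \<le> ennreal (sqrt (real n)) * (\<integral>\<^sup>+z. ennreal ((g n d z)\<^sup>2) \<partial>PZ)"
  shows "((\<lambda>(n, \<omega>). h n (train n \<omega>, test n \<omega>)) \<longlongrightarrow> 0) (in_prob M)"
proof (rule conditional_Markov_in_prob[where S = "\<lambda>n. \<Pi>\<^sub>M i\<in>I n. borel" and T = "\<lambda>n. \<Pi>\<^sub>M i\<in>J n. borel"])
  show "prob_space M" by (rule prob_space_axioms)
  show "\<forall>\<^sub>F n in sequentially. indep_var (\<Pi>\<^sub>M i\<in>I n. borel) (train n) (\<Pi>\<^sub>M i\<in>J n. borel) (test n)"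
    using eventually_ge_at_top[of 1]
  proof eventually_elim
    case (elim n)
    show ?case
      unfolding train_def[abs_def] test_def[abs_def] using split[OF elim] by (intro indep_var_restrict[OF indep_W]) auto
  qed
  show "\<forall>\<^sub>F n in sequentially. h n \<in> borel_measurable ((\<Pi>\<^sub>M i\<in>I n. borel) \<Otimes>\<^sub>M (\<Pi>\<^sub>M i\<in>J n. borel))"
    using eventually_ge_at_top[of 1] by eventually_elim (rule h)
  let ?g = "\<lambda>(n, \<omega>). ennreal (sqrt (real n)) * (\<integral>\<^sup>+z. ennreal ((g n (train n \<omega>) z)\<^sup>2) \<partial>PZ)"
  show "((\<lambda>(n, \<omega>). \<integral>\<^sup>+\<omega>'. h n (train n \<omega>, test n \<omega>') \<partial>M) \<longlongrightarrow> 0) (in_prob M)"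
  proof (rule tendsto_sandwich[OF _ _ tendsto_const])
    show "(?g \<longlongrightarrow> 0) (in_prob M)" using g by (simp add: negligible_error_def)
    show "\<forall>\<^sub>F x in in_prob M. (case x of (n, \<omega>) \<Rightarrow> \<integral>\<^sup>+\<omega>'. h n (train n \<omega>, test n \<omega>') \<partial>M) \<le> ?g x"
    proof (rule eventually_in_prob_everywhere)
      show "\<forall>\<^sub>F n in sequentially. \<forall>\<omega>\<in>space M.
        (case (n, \<omega>) of (n, \<omega>) \<Rightarrow> \<integral>\<^sup>+\<omega>'. h n (train n \<omega>, test n \<omega>') \<partial>M) \<le> ?g (n, \<omega>)"
        using eventually_ge_at_top[of 1]
        by eventually_elim (simp add: bound[OF _ train_space])
    qed
  qed simp
qed

lemma negligible_error_measurable: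
  assumes "negligible_error g" "n \<ge> 1"
  shows "d \<in> space (\<Pi>\<^sub>M i\<in>I n. borel) \<Longrightarrow> g n d \<in> borel_measurable borel"
    and "i \<in> J n \<Longrightarrow> (\<lambda>(d, w :: nat \<Rightarrow> real \<times> real \<times> 'z). g n d (snd (snd (w i)))) \<in>
      borel_measurable ((\<Pi>\<^sub>M i\<in>I n. borel) \<Otimes>\<^sub>M (\<Pi>\<^sub>M i\<in>J n. borel))"
proof -
  have m: "(\<lambda>(d, z). g n d z) \<in> borel_measurable ((\<Pi>\<^sub>M i\<in>I n. borel) \<Otimes>\<^sub>M borel)"
    using assms unfolding negligible_error_def by blast
  show "g n d \<in> borel_measurable borel" if "d \<in> space (\<Pi>\<^sub>M i\<in>I n. borel)"
    using measurable_Pair2[OF m that] unfolding prod.case .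
  show "(\<lambda>(d, w :: nat \<Rightarrow> real \<times> real \<times> 'z). g n d (snd (snd (w i)))) \<in>
      borel_measurable ((\<Pi>\<^sub>M i\<in>I n. borel) \<Otimes>\<^sub>M (\<Pi>\<^sub>M i\<in>J n. borel))" if i: "i \<in> J n"
  proof -
    let ?D = "\<Pi>\<^sub>M i\<in>I n. borel :: (real \<times> real \<times> 'z) measure"
    let ?E = "\<Pi>\<^sub>M i\<in>J n. borel :: (real \<times> real \<times> 'z) measure"
    have p: "(\<lambda>x. snd x i) \<in> measurable (?D \<Otimes>\<^sub>M ?E) borel"
      by (rule measurable_compose[OF measurable_snd measurable_component_singleton[OF i]])
    have "(\<lambda>x. snd (snd (snd x i))) \<in> measurable (?D \<Otimes>\<^sub>M ?E) borel"
      by (rule measurable_compose[OF p Z_projection_measurable])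
    then have "(\<lambda>x. (fst x, snd (snd (snd x i)))) \<in> measurable (?D \<Otimes>\<^sub>M ?E) (?D \<Otimes>\<^sub>M borel)"
      by (rule measurable_Pair[OF measurable_fst])
    from measurable_compose[OF this m] show ?thesis by (simp only: prod.case case_prod_beta' fst_conv snd_conv)
  qed
qed

text \<open>
  For fixed training data the mean of this quantity is exactly \<open>sqrt n * \<parallel>g\<parallel>\<^sup>2\<close>: here the rate
  \<open>n\<close> to the power \<open>-1/4\<close> is used to the full.
\<close>

lemma square_term_vanishes:
  assumes g: "negligible_error g"
  shows "((\<lambda>(n, \<omega>). (\<Sum>i\<in>J n. (g n (train n \<omega>) (Z i \<omega>))\<^sup>2) / sqrt (real n)) \<longlongrightarrow> 0) (in_prob M)"
proof -
  let ?h = "\<lambda>n (d, w :: nat \<Rightarrow> real \<times> real \<times> 'z). ennreal ((\<Sum>i\<in>J n. (g n d (snd (snd (w i))))\<^sup>2) / sqrt (real n))"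
  have vanish: "((\<lambda>(n, \<omega>). ?h n (train n \<omega>, test n \<omega>)) \<longlongrightarrow> 0) (in_prob M)"
  proof (rule conditional_vanishing[OF g])
    fix n :: nat assume n: "n \<ge> 1"
    note [measurable] = negligible_error_measurable(2)[OF g n, unfolded case_prod_beta']
    show "?h n \<in> borel_measurable ((\<Pi>\<^sub>M i\<in>I n. borel) \<Otimes>\<^sub>M (\<Pi>\<^sub>M i\<in>J n. borel))"
      unfolding case_prod_beta' by measurable
    fix d assume d: "d \<in> space (\<Pi>\<^sub>M i\<in>I n. borel :: (real \<times> real \<times> 'z) measure)"
    note gd[measurable] = negligible_error_measurable(1)[OF g n d]
    have [measurable]: "Z i \<in> borel_measurable M" if "i \<in> J n" for i using XYZ_measurable that split[OF n] by auto
    have "(\<integral>\<^sup>+\<omega>. ?h n (d, test n \<omega>) \<partial>M) = (\<integral>\<^sup>+\<omega>. ennreal (1 / sqrt (real n)) * ennreal (\<Sum>i\<in>J n. (g n d (Z i \<omega>))\<^sup>2) \<partial>M)"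
      by (intro nn_integral_cong) (simp add: test_def W_def sum_nonneg flip: ennreal_mult')
    also have "\<dots> = ennreal (1 / sqrt (real n)) * (\<integral>\<^sup>+\<omega>. ennreal (\<Sum>i\<in>J n. (g n d (Z i \<omega>))\<^sup>2) \<partial>M)"
      by (rule nn_integral_cmult) measurable
    also have "\<dots> = (ennreal (1 / sqrt (real n)) * of_nat n) * (\<integral>\<^sup>+z. ennreal ((g n d z)\<^sup>2) \<partial>PZ)"
      using sum_squares_expectation[OF gd, of "J n"] split[OF n] by (simp add: mult.assoc)
    also have "ennreal (1 / sqrt (real n)) * of_nat n = ennreal (sqrt (real n))"
      by (simp add: ennreal_of_nat_eq_real_of_nat real_div_sqrt flip: ennreal_mult')
    finally show "(\<integral>\<^sup>+\<omega>. ?h n (d, test n \<omega>) \<partial>M) \<le> ennreal (sqrt (real n)) * (\<integral>\<^sup>+z. ennreal ((g n d z)\<^sup>2) \<partial>PZ)"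
      by simp
  qed
  have eq: "(\<lambda>(n, \<omega>). ?h n (train n \<omega>, test n \<omega>)) =
      (\<lambda>x. ennreal (case x of (n, \<omega>) \<Rightarrow> (\<Sum>i\<in>J n. (g n (train n \<omega>) (Z i \<omega>))\<^sup>2) / sqrt (real n)))"
    by (auto simp: fun_eq_iff test_def W_def)
  show ?thesis
    by (rule tendsto_zero_of_ennreal[OF _ vanish[unfolded eq]]) (auto simp: sum_nonneg)
qed

text \<open>
  For fixed training data the second moment is at most \<open>\<parallel>g\<parallel>\<^sup>2\<close>. The centring of the errors is
  essential: without cancellation the quantity would be of order \<open>sqrt n * \<parallel>g\<parallel>\<close>.
\<close>

lemma error_term_vanishes:
  assumes g: "negligible_error g" and \<phi>: "\<phi> \<in> {\<xi>, \<eta>}"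
  shows "((\<lambda>(n, \<omega>). (\<Sum>i\<in>J n. \<phi> (W i \<omega>) * g n (train n \<omega>) (Z i \<omega>)) / sqrt (real n)) \<longlongrightarrow> 0) (in_prob M)"
proof -
  have \<phi>m[measurable]: "\<phi> \<in> borel_measurable borel" using \<phi> by auto
  let ?h = "\<lambda>n (d, w :: nat \<Rightarrow> real \<times> real \<times> 'z). ennreal (((\<Sum>i\<in>J n. \<phi> (w i) * g n d (snd (snd (w i)))) / sqrt (real n))\<^sup>2)"
  have vanish: "((\<lambda>(n, \<omega>). ?h n (train n \<omega>, test n \<omega>)) \<longlongrightarrow> 0) (in_prob M)"
  proof (rule conditional_vanishing[OF g])
    fix n :: nat assume n: "n \<ge> 1"
    note [measurable] = negligible_error_measurable(2)[OF g n, unfolded case_prod_beta']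
    show "?h n \<in> borel_measurable ((\<Pi>\<^sub>M i\<in>I n. borel) \<Otimes>\<^sub>M (\<Pi>\<^sub>M i\<in>J n. borel))"
      unfolding case_prod_beta' by measurable
    fix d assume d: "d \<in> space (\<Pi>\<^sub>M i\<in>I n. borel :: (real \<times> real \<times> 'z) measure)"
    note gd[measurable] = negligible_error_measurable(1)[OF g n d]
    have [measurable]: "Z i \<in> borel_measurable M" "W i \<in> borel_measurable M" if "i \<in> J n" for i
      using XYZ_measurable W_measurable that split[OF n] by auto
    have "(\<integral>\<^sup>+\<omega>. ?h n (d, test n \<omega>) \<partial>M) =
        (\<integral>\<^sup>+\<omega>. ennreal (1 / real n) * ennreal ((\<Sum>i\<in>J n. \<phi> (W i \<omega>) * g n d (Z i \<omega>))\<^sup>2) \<partial>M)"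
      by (intro nn_integral_cong) (simp add: test_def W_def power_divide flip: ennreal_mult')
    also have "\<dots> = ennreal (1 / real n) * (\<integral>\<^sup>+\<omega>. ennreal ((\<Sum>i\<in>J n. \<phi> (W i \<omega>) * g n d (Z i \<omega>))\<^sup>2) \<partial>M)"
      by (rule nn_integral_cmult) measurable
    also have "\<dots> \<le> ennreal (1 / real n) * (of_nat n * (\<integral>\<^sup>+z. ennreal ((g n d z)\<^sup>2) \<partial>PZ))"
      using error_sum_expectation[OF gd, of "J n" \<phi>] split[OF n] \<phi> by (intro mult_left_mono) auto
    also have "\<dots> = (ennreal (1 / real n) * of_nat n) * (\<integral>\<^sup>+z. ennreal ((g n d z)\<^sup>2) \<partial>PZ)"
      by (simp add: mult.assoc)
    also have "ennreal (1 / real n) * of_nat n = ennreal 1"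
      using n by (simp add: ennreal_of_nat_eq_real_of_nat flip: ennreal_mult')
    also have "ennreal 1 * (\<integral>\<^sup>+z. ennreal ((g n d z)\<^sup>2) \<partial>PZ) \<le> ennreal (sqrt (real n)) * (\<integral>\<^sup>+z. ennreal ((g n d z)\<^sup>2) \<partial>PZ)"
      using n by (intro mult_right_mono ennreal_leI) auto
    finally show "(\<integral>\<^sup>+\<omega>. ?h n (d, test n \<omega>) \<partial>M) \<le> ennreal (sqrt (real n)) * (\<integral>\<^sup>+z. ennreal ((g n d z)\<^sup>2) \<partial>PZ)" .
  qed
  have eq: "(\<lambda>(n, \<omega>). ?h n (train n \<omega>, test n \<omega>)) =
      (\<lambda>x. ennreal ((case x of (n, \<omega>) \<Rightarrow> (\<Sum>i\<in>J n. \<phi> (W i \<omega>) * g n (train n \<omega>) (Z i \<omega>)) / sqrt (real n))\<^sup>2))"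
    by (auto simp: fun_eq_iff test_def W_def)
  show ?thesis
    by (rule tendsto_zero_of_ennreal_square[OF vanish[unfolded eq]])
qed

text \<open>
  With \<open>q\<close> the fourth root of \<open>n\<close>, the estimation errors change \<open>q\<^sup>2 * A\<close>, \<open>q\<^sup>2 * B\<close> and
  \<open>q\<^sup>2 * C\<close> only by quantities that vanish in probability. They are therefore invisible in the
  linear part \<open>q\<^sup>2 * (C - \<rho> * (A + B) / 2)\<close>, which reduces to the sum of \<open>\<psi>\<close>, and they do not
  spoil the rate of \<open>A, B, C\<close> that makes the nonlinear remainder vanish.
\<close>

lemma residual_expansion:
  assumes gx: "negligible_error gx" and gy: "negligible_error gy"
  defines "u \<equiv> \<lambda>n \<omega> i. \<xi> (W i \<omega>) + gx n (train n \<omega>) (Z i \<omega>)"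
    and "v \<equiv> \<lambda>n \<omega> i. \<eta> (W i \<omega>) + gy n (train n \<omega>) (Z i \<omega>)"
  shows "((\<lambda>(n, \<omega>). sqrt (real n) * (residual_corr (J n) (\<lambda>i. \<sigma>x * u n \<omega> i) (\<lambda>i. \<sigma>y * v n \<omega> i) - \<rho>)
      - (\<Sum>i\<in>J n. \<psi> (W i \<omega>)) / sqrt (real n)) \<longlongrightarrow> 0) (in_prob M)"
proof -
  let ?F = "in_prob M"
  define q where "q p = sqrt (sqrt (real (fst p)))" for p :: "nat \<times> 'a"
  define \<Sigma> where "\<Sigma> h p = (\<Sum>i\<in>J (fst p). h p i :: real)" for h and p :: "nat \<times> 'a"
  define x where "x p i = \<xi> (W i (snd p))" for p :: "nat \<times> 'a" and i
  define y where "y p i = \<eta> (W i (snd p))" for p :: "nat \<times> 'a" and i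
  define a where "a p i = gx (fst p) (train (fst p) (snd p)) (Z i (snd p))" for p :: "nat \<times> 'a" and i
  define b where "b p i = gy (fst p) (train (fst p) (snd p)) (Z i (snd p))" for p :: "nat \<times> 'a" and i
  note defs = \<Sigma>_def x_def y_def a_def b_def q_def
  have Jn: "n \<ge> 1 \<Longrightarrow> J n \<subseteq> {1..} \<and> finite (J n) \<and> card (J n) = n" for n using split by blast
  have n1: "\<forall>\<^sub>F p in ?F. 1 \<le> fst p"
    by (rule eventually_compose_filterlim[OF eventually_ge_at_top filterlim_fst_in_prob])
  have q1: "\<forall>\<^sub>F p in ?F. 1 \<le> q p"
    using n1 by eventually_elim (simp add: q_def)
  have q2: "(q p)\<^sup>2 = sqrt (real (fst p))" for p by (simp add: q_def)
  have q4: "(q p) ^ 4 = real (fst p)" for p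
  proof -
    have "(q p) ^ 4 = ((q p)\<^sup>2)\<^sup>2" by (simp flip: power_mult)
    then show ?thesis unfolding q2 by simp
  qed
  have qinv: "((\<lambda>p. 1 / q p) \<longlongrightarrow> 0) ?F"
  proof -
    have "filterlim q at_top ?F"
      unfolding q_def
      by (intro filterlim_compose[OF sqrt_at_top] filterlim_compose[OF filterlim_real_sequentially]
          filterlim_fst_in_prob)
    then show ?thesis
      by (intro tendsto_divide_0[OF tendsto_const] filterlim_at_top_imp_at_infinity)
  qed
  \<comment> \<open>in names of limits, \<open>x, y\<close> stand for the errors and \<open>a, b\<close> for the estimation errors\<close>
  have aa: "((\<lambda>p. \<Sigma> (\<lambda>p i. (a p i)\<^sup>2) p / (q p)\<^sup>2) \<longlongrightarrow> 0) ?F"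
    using square_term_vanishes[OF gx] unfolding q2 by (simp add: defs case_prod_beta')
  have bb: "((\<lambda>p. \<Sigma> (\<lambda>p i. (b p i)\<^sup>2) p / (q p)\<^sup>2) \<longlongrightarrow> 0) ?F"
    using square_term_vanishes[OF gy] unfolding q2 by (simp add: defs case_prod_beta')
  have xa: "((\<lambda>p. \<Sigma> (\<lambda>p i. x p i * a p i) p / (q p)\<^sup>2) \<longlongrightarrow> 0) ?F"
    using error_term_vanishes[OF gx, of \<xi>] unfolding q2 by (simp add: defs case_prod_beta')
  have xb: "((\<lambda>p. \<Sigma> (\<lambda>p i. x p i * b p i) p / (q p)\<^sup>2) \<longlongrightarrow> 0) ?F"
    using error_term_vanishes[OF gy, of \<xi>] unfolding q2 by (simp add: defs case_prod_beta')
  have ya: "((\<lambda>p. \<Sigma> (\<lambda>p i. y p i * a p i) p / (q p)\<^sup>2) \<longlongrightarrow> 0) ?F"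
    using error_term_vanishes[OF gx, of \<eta>] unfolding q2 by (simp add: defs case_prod_beta')
  have yb: "((\<lambda>p. \<Sigma> (\<lambda>p i. y p i * b p i) p / (q p)\<^sup>2) \<longlongrightarrow> 0) ?F"
    using error_term_vanishes[OF gy, of \<eta>] unfolding q2 by (simp add: defs case_prod_beta')
  have ab: "((\<lambda>p. \<Sigma> (\<lambda>p i. a p i * b p i) p / (q p)\<^sup>2) \<longlongrightarrow> 0) ?F"
  proof (rule Lim_null_comparison)
    show "((\<lambda>p. \<Sigma> (\<lambda>p i. (a p i)\<^sup>2) p / (q p)\<^sup>2 + \<Sigma> (\<lambda>p i. (b p i)\<^sup>2) p / (q p)\<^sup>2) \<longlongrightarrow> 0) ?F"
      using tendsto_add[OF aa bb] by simp
    have "\<bar>r * s\<bar> \<le> r\<^sup>2 + s\<^sup>2" for r s :: real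
    proof -
      have "2 * \<bar>r * s\<bar> \<le> r\<^sup>2 + s\<^sup>2"
        using sum_squares_bound[of "\<bar>r\<bar>" "\<bar>s\<bar>"] by (simp add: abs_mult)
      then show ?thesis using zero_le_power2[of r] zero_le_power2[of s] by linarith
    qed
    then have "\<bar>\<Sigma> (\<lambda>p i. a p i * b p i) p\<bar> \<le> \<Sigma> (\<lambda>p i. (a p i)\<^sup>2) p + \<Sigma> (\<lambda>p i. (b p i)\<^sup>2) p" for p
      unfolding \<Sigma>_def sum.distrib[symmetric] by (intro order_trans[OF sum_abs] sum_mono)
    then show "\<forall>\<^sub>F p in ?F. norm (\<Sigma> (\<lambda>p i. a p i * b p i) p / (q p)\<^sup>2) \<le>
        \<Sigma> (\<lambda>p i. (a p i)\<^sup>2) p / (q p)\<^sup>2 + \<Sigma> (\<lambda>p i. (b p i)\<^sup>2) p / (q p)\<^sup>2"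
      by (intro always_eventually allI)
        (simp add: abs_divide divide_right_mono flip: add_divide_distrib)
  qed
  have rate: "((\<lambda>p. \<Sigma> (\<lambda>p i. h (W i (snd p))) p / (q p) ^ 3) \<longlongrightarrow> 0) ?F"
    if "h \<in> borel_measurable borel" "\<And>i. i \<ge> 1 \<Longrightarrow> has_bochner_integral M (\<lambda>\<omega>. h (W i \<omega>)) 0"
      "\<And>i. i \<ge> 1 \<Longrightarrow> integrable M (\<lambda>\<omega>. (h (W i \<omega>))\<^sup>2)" for h
    using centred_sum_rate[where h = h and J = J, OF that Jn] by (simp add: \<Sigma>_def q_def case_prod_beta')
  have one: "has_bochner_integral M (\<lambda>\<omega>. c) c" for c :: real
    by (simp add: has_bochner_integral_iff prob_space)
  have xx: "((\<lambda>p. \<Sigma> (\<lambda>p i. (x p i)\<^sup>2 - 1) p / (q p) ^ 3) \<longlongrightarrow> 0) ?F"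
    unfolding x_def
    by (rule rate[of "\<lambda>w. (\<xi> w)\<^sup>2 - 1"])
      (use has_bochner_integral_diff[OF error_second_order(3) one[of 1]] error_fourth_order(1) in auto)
  have yy: "((\<lambda>p. \<Sigma> (\<lambda>p i. (y p i)\<^sup>2 - 1) p / (q p) ^ 3) \<longlongrightarrow> 0) ?F"
    unfolding y_def
    by (rule rate[of "\<lambda>w. (\<eta> w)\<^sup>2 - 1"])
      (use has_bochner_integral_diff[OF error_second_order(4) one[of 1]] error_fourth_order(2) in auto)
  have xy: "((\<lambda>p. \<Sigma> (\<lambda>p i. x p i * y p i - \<rho>) p / (q p) ^ 3) \<longlongrightarrow> 0) ?F"
    unfolding x_def y_def
    by (rule rate[of "\<lambda>w. \<xi> w * \<eta> w - \<rho>"])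
      (use has_bochner_integral_diff[OF error_second_order(5) one[of \<rho>]] error_fourth_order(3) in auto)
  define A where "A p = \<Sigma> (\<lambda>p i. (x p i + a p i)\<^sup>2) p / real (fst p)" for p
  define B where "B p = \<Sigma> (\<lambda>p i. (y p i + b p i)\<^sup>2) p / real (fst p)" for p
  define C where "C p = \<Sigma> (\<lambda>p i. (x p i + a p i) * (y p i + b p i)) p / real (fst p)" for p
  \<comment> \<open>the factor \<open>q p ^ 4\<close> is the number \<open>n\<close> of test indices\<close>
  have centre: "\<Sigma> (\<lambda>p i. h p i - c) p = \<Sigma> h p - c * q p ^ 4" if "1 \<le> fst p" for h c p
    using Jn[OF that] by (simp add: \<Sigma>_def sum_subtractf q4)
  have sums: "\<Sigma> (\<lambda>p i. (x p i + a p i)\<^sup>2) p = \<Sigma> (\<lambda>p i. (x p i)\<^sup>2) p + 2 * \<Sigma> (\<lambda>p i. x p i * a p i) p + \<Sigma> (\<lambda>p i. (a p i)\<^sup>2) p"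
    "\<Sigma> (\<lambda>p i. (y p i + b p i)\<^sup>2) p = \<Sigma> (\<lambda>p i. (y p i)\<^sup>2) p + 2 * \<Sigma> (\<lambda>p i. y p i * b p i) p + \<Sigma> (\<lambda>p i. (b p i)\<^sup>2) p"
    "\<Sigma> (\<lambda>p i. (x p i + a p i) * (y p i + b p i)) p = \<Sigma> (\<lambda>p i. x p i * y p i) p + \<Sigma> (\<lambda>p i. x p i * b p i) p
       + \<Sigma> (\<lambda>p i. y p i * a p i) p + \<Sigma> (\<lambda>p i. a p i * b p i) p" for p
    unfolding \<Sigma>_def sum_distrib_left sum.distrib[symmetric]
    by (auto intro!: sum.cong simp: power2_eq_square algebra_simps)
  have qA: "((\<lambda>p. q p * (A p - 1)) \<longlongrightarrow> 0) ?F"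
  proof (rule Lim_transform_eventually)
    show "((\<lambda>p. \<Sigma> (\<lambda>p i. (x p i)\<^sup>2 - 1) p / (q p) ^ 3 + (1 / q p) *
        (2 * (\<Sigma> (\<lambda>p i. x p i * a p i) p / (q p)\<^sup>2) + \<Sigma> (\<lambda>p i. (a p i)\<^sup>2) p / (q p)\<^sup>2)) \<longlongrightarrow> 0) ?F"
      by (rule tendsto_eq_intros xx qinv xa aa refl | simp)+
    show "\<forall>\<^sub>F p in ?F. \<Sigma> (\<lambda>p i. (x p i)\<^sup>2 - 1) p / (q p) ^ 3 + (1 / q p) *
        (2 * (\<Sigma> (\<lambda>p i. x p i * a p i) p / (q p)\<^sup>2) + \<Sigma> (\<lambda>p i. (a p i)\<^sup>2) p / (q p)\<^sup>2) = q p * (A p - 1)"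
      using n1 q1
    proof eventually_elim
      case (elim p)
      then have "q p \<noteq> 0" by auto
      then show ?case
        unfolding A_def q4[symmetric] sums centre[OF elim(1)]
        by (simp add: field_simps power2_eq_square power3_eq_cube power4_eq_xxxx)
    qed
  qed
  have qB: "((\<lambda>p. q p * (B p - 1)) \<longlongrightarrow> 0) ?F"
  proof (rule Lim_transform_eventually)
    show "((\<lambda>p. \<Sigma> (\<lambda>p i. (y p i)\<^sup>2 - 1) p / (q p) ^ 3 + (1 / q p) *
        (2 * (\<Sigma> (\<lambda>p i. y p i * b p i) p / (q p)\<^sup>2) + \<Sigma> (\<lambda>p i. (b p i)\<^sup>2) p / (q p)\<^sup>2)) \<longlongrightarrow> 0) ?F"
      by (rule tendsto_eq_intros yy qinv yb bb refl | simp)+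
    show "\<forall>\<^sub>F p in ?F. \<Sigma> (\<lambda>p i. (y p i)\<^sup>2 - 1) p / (q p) ^ 3 + (1 / q p) *
        (2 * (\<Sigma> (\<lambda>p i. y p i * b p i) p / (q p)\<^sup>2) + \<Sigma> (\<lambda>p i. (b p i)\<^sup>2) p / (q p)\<^sup>2) = q p * (B p - 1)"
      using n1 q1
    proof eventually_elim
      case (elim p)
      then have "q p \<noteq> 0" by auto
      then show ?case
        unfolding B_def q4[symmetric] sums centre[OF elim(1)]
        by (simp add: field_simps power2_eq_square power3_eq_cube power4_eq_xxxx)
    qed
  qed
  have qC: "((\<lambda>p. q p * (C p - \<rho>)) \<longlongrightarrow> 0) ?F"
  proof (rule Lim_transform_eventually)
    show "((\<lambda>p. \<Sigma> (\<lambda>p i. x p i * y p i - \<rho>) p / (q p) ^ 3 + (1 / q p) *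
        (\<Sigma> (\<lambda>p i. x p i * b p i) p / (q p)\<^sup>2 + \<Sigma> (\<lambda>p i. y p i * a p i) p / (q p)\<^sup>2 +
         \<Sigma> (\<lambda>p i. a p i * b p i) p / (q p)\<^sup>2)) \<longlongrightarrow> 0) ?F"
      by (rule tendsto_eq_intros xy qinv xb ya ab refl | simp)+
    show "\<forall>\<^sub>F p in ?F. \<Sigma> (\<lambda>p i. x p i * y p i - \<rho>) p / (q p) ^ 3 + (1 / q p) *
        (\<Sigma> (\<lambda>p i. x p i * b p i) p / (q p)\<^sup>2 + \<Sigma> (\<lambda>p i. y p i * a p i) p / (q p)\<^sup>2 +
         \<Sigma> (\<lambda>p i. a p i * b p i) p / (q p)\<^sup>2) = q p * (C p - \<rho>)"
      using n1 q1
    proof eventually_elim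
      case (elim p)
      then have "q p \<noteq> 0" by auto
      then show ?case
        unfolding C_def q4[symmetric] sums centre[OF elim(1)]
        by (simp add: field_simps power2_eq_square power3_eq_cube power4_eq_xxxx)
    qed
  qed
  let ?R = "\<lambda>p. \<Sigma> (\<lambda>p i. x p i * b p i) p / (q p)\<^sup>2 + \<Sigma> (\<lambda>p i. y p i * a p i) p / (q p)\<^sup>2 +
         \<Sigma> (\<lambda>p i. a p i * b p i) p / (q p)\<^sup>2 - \<rho> / 2 *
         (2 * (\<Sigma> (\<lambda>p i. x p i * a p i) p / (q p)\<^sup>2) + \<Sigma> (\<lambda>p i. (a p i)\<^sup>2) p / (q p)\<^sup>2 +
          (2 * (\<Sigma> (\<lambda>p i. y p i * b p i) p / (q p)\<^sup>2) + \<Sigma> (\<lambda>p i. (b p i)\<^sup>2) p / (q p)\<^sup>2))"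
  have R: "(?R \<longlongrightarrow> 0) ?F"
    by (rule tendsto_eq_intros xa xb ya yb ab aa bb refl | simp)+
  have "((\<lambda>p. (q p)\<^sup>2 * (C p / (sqrt (A p) * sqrt (B p)) - \<rho> - (C p - \<rho> * (A p + B p) / 2)) + ?R p) \<longlongrightarrow> 0) ?F"
    using tendsto_add[OF correlation_linearisation[OF q1 qA qB qC] R] by simp
  moreover have "\<forall>\<^sub>F p in ?F.
      (q p)\<^sup>2 * (C p / (sqrt (A p) * sqrt (B p)) - \<rho> - (C p - \<rho> * (A p + B p) / 2)) + ?R p =
      (case p of (n, \<omega>) \<Rightarrow> sqrt (real n) * (residual_corr (J n) (\<lambda>i. \<sigma>x * u n \<omega> i) (\<lambda>i. \<sigma>y * v n \<omega> i) - \<rho>)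
      - (\<Sum>i\<in>J n. \<psi> (W i \<omega>)) / sqrt (real n))"
    using n1 q1
  proof eventually_elim
    case (elim p)
    then have q0: "q p \<noteq> 0" by auto
    have n0: "0 < real (fst p)" using elim by simp
    have corr: "residual_corr (J (fst p)) (\<lambda>i. \<sigma>x * u (fst p) (snd p) i) (\<lambda>i. \<sigma>y * v (fst p) (snd p) i) =
        C p / (sqrt (A p) * sqrt (B p))"
      unfolding residual_corr_scale[OF parameters(1,2) n0] A_def B_def C_def
      by (simp add: \<Sigma>_def x_def y_def a_def b_def u_def v_def)
    have \<psi>_sum: "(\<Sum>i\<in>J (fst p). \<psi> (W i (snd p))) =
        \<Sigma> (\<lambda>p i. x p i * y p i) p - \<rho> / 2 * (\<Sigma> (\<lambda>p i. (x p i)\<^sup>2) p + \<Sigma> (\<lambda>p i. (y p i)\<^sup>2) p)"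
      unfolding \<Sigma>_def sum.distrib[symmetric] sum_distrib_left sum_subtractf[symmetric]
      by (simp add: \<psi>_def x_def y_def)
    have lin: "(q p)\<^sup>2 * (C p - \<rho> * (A p + B p) / 2) = (\<Sum>i\<in>J (fst p). \<psi> (W i (snd p))) / (q p)\<^sup>2 + ?R p"
      unfolding \<psi>_sum A_def B_def C_def q4[symmetric] sums using q0
      by (simp add: field_simps power2_eq_square power4_eq_xxxx)
    show ?case
      unfolding case_prod_beta' corr q2[symmetric] right_diff_distrib[of _ _ "C p - _"] lin by simp
  qed
  ultimately show ?thesis
    by (rule Lim_transform_eventually)
qed

text \<open>
  Outside the event where the norm exceeds \<open>e\<close> times \<open>n\<close> to the power \<open>-1/4\<close>, the squared norm
  is at most \<open>e\<^sup>2 / sqrt n\<close>.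
\<close>

lemma estimator_negligible:
  assumes T: "\<And>n. n \<ge> 1 \<Longrightarrow> regression_estimator (I n) (T n)"
    and m[measurable]: "m \<in> borel_measurable borel" and \<sigma>: "0 < \<sigma>"
    and small: "small_o_p M (\<lambda>n \<omega>. L2_norm PZ (\<lambda>z. fitted W (I n) (T n) \<omega> z - m z))
      (\<lambda>n. real n powr (- 1 / 4))"
  shows "negligible_error (\<lambda>n d z. (m z - T n d z) / \<sigma>)"
  unfolding negligible_error_def
proof (intro conjI allI impI)
  fix n :: nat assume "n \<ge> 1"
  have [measurable]: "(\<lambda>x. T n (fst x) (snd x)) \<in> borel_measurable ((\<Pi>\<^sub>M i\<in>I n. borel) \<Otimes>\<^sub>M borel)"
    using T[OF \<open>n \<ge> 1\<close>] by (simp add: regression_estimator_def case_prod_beta')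
  show "(\<lambda>(d, z). (m z - T n d z) / \<sigma>) \<in> borel_measurable ((\<Pi>\<^sub>M i\<in>I n. borel) \<Otimes>\<^sub>M borel)"
    unfolding case_prod_beta' by measurable
next
  show "((\<lambda>(n, \<omega>). ennreal (sqrt (real n)) *
      (\<integral>\<^sup>+z. ennreal (((m z - T n (train n \<omega>) z) / \<sigma>)\<^sup>2) \<partial>PZ)) \<longlongrightarrow> 0) (in_prob M)"
  proof (rule order_tendstoI)
    fix \<delta> :: ennreal assume "0 < \<delta>"
    then obtain \<delta>' where "0 < \<delta>'" "\<delta>' < \<delta>" using dense by blast
    then obtain d where d: "0 < d" "ennreal d < \<delta>"
      by (cases \<delta>') (auto simp: top_unique)
      \<comment> \<open>chosen so that a squared norm of \<open>e\<^sup>2 / sqrt n\<close>, divided by \<open>\<sigma>\<^sup>2\<close> and multiplied by \<open>sqrt n\<close>, is \<open>d\<close>\<close>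
    define e where "e = sqrt d * \<sigma>"
    have e: "0 < e" "e\<^sup>2 / \<sigma>\<^sup>2 = d" using d \<sigma> by (simp_all add: e_def power_mult_distrib)
    show "\<forall>\<^sub>F p in in_prob M. (case p of (n, \<omega>) \<Rightarrow> ennreal (sqrt (real n)) *
      (\<integral>\<^sup>+z. ennreal (((m z - T n (train n \<omega>) z) / \<sigma>)\<^sup>2) \<partial>PZ)) < \<delta>"
      unfolding eventually_in_prob
    proof (intro allI impI)
      fix r :: real assume "0 < r"
      have "(\<lambda>n. measure M {\<omega>\<in>space M. L2_norm PZ (\<lambda>z. fitted W (I n) (T n) \<omega> z - m z) > ennreal (e * real n powr (- 1 / 4))}) \<longlonglongrightarrow> 0"
        using small e(1) unfolding small_o_p_def by blast
      from order_tendstoD(2)[OF this \<open>0 < r\<close>] eventually_ge_at_top[of 1]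
      show "\<forall>\<^sub>F n in sequentially. \<exists>A\<in>sets M. emeasure M A \<le> ennreal r \<and> (\<forall>\<omega>\<in>space M - A.
         (case (n, \<omega>) of (n, \<omega>) \<Rightarrow> ennreal (sqrt (real n)) *
           (\<integral>\<^sup>+z. ennreal (((m z - T n (train n \<omega>) z) / \<sigma>)\<^sup>2) \<partial>PZ)) < \<delta>)"
      proof eventually_elim
        case (elim n)
        let ?L = "\<lambda>\<omega>. L2_norm PZ (\<lambda>z. fitted W (I n) (T n) \<omega> z - m z)"
        let ?A = "{\<omega>\<in>space M. ?L \<omega> > ennreal (e * real n powr (- 1 / 4))}"
        have Tm: "(\<lambda>x. T n (fst x) (snd x)) \<in> borel_measurable ((\<Pi>\<^sub>M i\<in>I n. borel) \<Otimes>\<^sub>M borel)"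
          using T[OF elim(2)] by (simp add: regression_estimator_def case_prod_beta')
        have In: "i \<in> I n \<Longrightarrow> W i \<in> borel_measurable M" for i
          using split[OF elim(2)] W_measurable by auto
        have D: "train n \<in> measurable M (\<Pi>\<^sub>M i\<in>I n. borel)"
          unfolding train_def[abs_def] by (intro measurable_restrict In)
        have PZ_sets: "sets PZ = sets borel" by (simp add: PZ_def)
        interpret PZ: prob_space PZ
          unfolding PZ_def using XYZ_measurable(3)[of 1] by (intro prob_space_distr) auto
        have "(\<lambda>x. (train n (fst x), snd x)) \<in> measurable (M \<Otimes>\<^sub>M PZ) ((\<Pi>\<^sub>M i\<in>I n. borel) \<Otimes>\<^sub>M borel)"
          by (rule measurable_Pair[OF measurable_compose[OF measurable_fst D]])
            (simp add: measurable_cong_sets[OF refl PZ_sets, symmetric])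
        from measurable_compose[OF this Tm]
        have TD[measurable]: "(\<lambda>x. T n (train n (fst x)) (snd x)) \<in> borel_measurable (M \<Otimes>\<^sub>M PZ)" by simp
        have mz[measurable]: "m \<in> borel_measurable PZ"
          using m measurable_cong_sets[OF PZ_sets refl] by blast
        have "(\<lambda>\<omega>. \<integral>\<^sup>+z. ennreal ((T n (train n \<omega>) z - m z)\<^sup>2) \<partial>PZ) \<in> borel_measurable M"
          by (rule PZ.borel_measurable_nn_integral) (simp add: case_prod_beta')
        then have Lm[measurable]: "?L \<in> borel_measurable M"
          unfolding L2_norm_def fitted_def Let_def train_def by measurable
        have A: "?A \<in> sets M" by measurable
        have small_A: "emeasure M ?A \<le> ennreal r"
          using elim(1) unfolding emeasure_eq_measure by (intro ennreal_leI less_imp_le)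
        have "ennreal (sqrt (real n)) * (\<integral>\<^sup>+z. ennreal (((m z - T n (train n \<omega>) z) / \<sigma>)\<^sup>2) \<partial>PZ) < \<delta>"
          if \<omega>: "\<omega> \<in> space M - ?A" for \<omega>
        proof -
          have "train n \<omega> \<in> space (\<Pi>\<^sub>M i\<in>I n. borel)" by (rule train_space)
          from measurable_Pair2[OF Tm this] have "(\<lambda>z. T n (train n \<omega>) z) \<in> borel_measurable borel" by simp
          then have [measurable]: "T n (train n \<omega>) \<in> borel_measurable PZ"
            using measurable_cong_sets[OF PZ_sets refl] by blast
          let ?I = "\<integral>\<^sup>+z. ennreal ((T n (train n \<omega>) z - m z)\<^sup>2) \<partial>PZ"
          have "?L \<omega> \<le> ennreal (e * real n powr (- 1 / 4))" using \<omega> by auto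
          from L2_norm_le_imp[OF this]
          have I: "?I \<le> ennreal ((e * real n powr (- 1 / 4))\<^sup>2)"
            using e(1) by (simp add: fitted_def train_def)
          have "(real n powr (- 1 / 4))\<^sup>2 = real n powr (- 1 / 2)"
            using elim(2) by (simp add: powr_power)
          also have "\<dots> = 1 / sqrt (real n)"
            using elim(2) by (simp add: powr_minus_divide powr_half_sqrt)
          finally have p2: "(real n powr (- 1 / 4))\<^sup>2 = 1 / sqrt (real n)" .
          have "(\<integral>\<^sup>+z. ennreal (((m z - T n (train n \<omega>) z) / \<sigma>)\<^sup>2) \<partial>PZ) =
              (\<integral>\<^sup>+z. ennreal (1 / \<sigma>\<^sup>2) * ennreal ((T n (train n \<omega>) z - m z)\<^sup>2) \<partial>PZ)"
            by (intro nn_integral_cong) (simp add: power_divide power2_commute flip: ennreal_mult')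
          also have "\<dots> = ennreal (1 / \<sigma>\<^sup>2) * ?I"
            by (rule nn_integral_cmult) measurable
          also have "\<dots> \<le> ennreal (1 / \<sigma>\<^sup>2) * ennreal ((e * real n powr (- 1 / 4))\<^sup>2)"
            by (intro mult_left_mono I) auto
          finally have "ennreal (sqrt (real n)) * (\<integral>\<^sup>+z. ennreal (((m z - T n (train n \<omega>) z) / \<sigma>)\<^sup>2) \<partial>PZ)
            \<le> ennreal (sqrt (real n)) * (ennreal (1 / \<sigma>\<^sup>2) * ennreal ((e * real n powr (- 1 / 4))\<^sup>2))"
            by (intro mult_left_mono) auto
          also have "\<dots> = ennreal (sqrt (real n) * (1 / \<sigma>\<^sup>2 * (e * real n powr (- 1 / 4))\<^sup>2))"
            by (simp flip: ennreal_mult')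
          also have "sqrt (real n) * (1 / \<sigma>\<^sup>2 * (e * real n powr (- 1 / 4))\<^sup>2) = d"
            unfolding power_mult_distrib p2 using elim(2) e(2) by simp
          finally show ?thesis using d(2) by simp
        qed
        then show ?case using A small_A by (intro bexI[of _ ?A]) auto
      qed
    qed
  qed simp
qed

lemma half_sample_expansion:
  assumes Tx: "\<And>n. n \<ge> 1 \<Longrightarrow> regression_estimator (I n) (Tx n)"
    and Ty: "\<And>n. n \<ge> 1 \<Longrightarrow> regression_estimator (I n) (Ty n)"
    and small_x: "small_o_p M (\<lambda>n \<omega>. L2_norm PZ (\<lambda>z. fitted W (I n) (Tx n) \<omega> z - mx z))
      (\<lambda>n. real n powr (- 1 / 4))"
    and small_y: "small_o_p M (\<lambda>n \<omega>. L2_norm PZ (\<lambda>z. fitted W (I n) (Ty n) \<omega> z - my z))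
      (\<lambda>n. real n powr (- 1 / 4))"
  shows "((\<lambda>(n, \<omega>). sqrt (real n) * (residual_corr (J n)
        (\<lambda>i. X i \<omega> - fitted W (I n) (Tx n) \<omega> (Z i \<omega>))
        (\<lambda>i. Y i \<omega> - fitted W (I n) (Ty n) \<omega> (Z i \<omega>)) - \<rho>)
      - (\<Sum>i\<in>J n. \<psi> (W i \<omega>)) / sqrt (real n)) \<longlongrightarrow> 0) (in_prob M)"
proof -
  have "\<sigma>x * (\<xi> (W i \<omega>) + (mx (Z i \<omega>) - Tx n (train n \<omega>) (Z i \<omega>)) / \<sigma>x) =
      X i \<omega> - fitted W (I n) (Tx n) \<omega> (Z i \<omega>)"
    "\<sigma>y * (\<eta> (W i \<omega>) + (my (Z i \<omega>) - Ty n (train n \<omega>) (Z i \<omega>)) / \<sigma>y) =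
      Y i \<omega> - fitted W (I n) (Ty n) \<omega> (Z i \<omega>)" for n i \<omega>
    using parameters(1,2) by (simp_all add: \<xi>_def \<eta>_def W_def fitted_def train_def field_simps)
  note eq = this
  show ?thesis
    using residual_expansion[OF estimator_negligible[OF Tx regression_measurable(1) parameters(1) small_x]
        estimator_negligible[OF Ty regression_measurable(2) parameters(2) small_y]]
    unfolding eq .
qed

lemma residual_corr_measurable:
  assumes n: "n \<ge> 1"
    and Tx: "regression_estimator (I n) (Tx n)" and Ty: "regression_estimator (I n) (Ty n)"
  shows "(\<lambda>\<omega>. residual_corr (J n)
        (\<lambda>i. X i \<omega> - fitted W (I n) (Tx n) \<omega> (Z i \<omega>))
        (\<lambda>i. Y i \<omega> - fitted W (I n) (Ty n) \<omega> (Z i \<omega>))) \<in> borel_measurable M"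
proof -
  have fit: "(\<lambda>\<omega>. fitted W (I n) (T n) \<omega> (Z i \<omega>)) \<in> borel_measurable M"
    if T: "regression_estimator (I n) (T n)" and i: "i \<in> J n" for T :: "nat \<Rightarrow> (nat \<Rightarrow> real \<times> real \<times> 'z) \<Rightarrow> 'z \<Rightarrow> real" and i
  proof -
    have Tm: "(\<lambda>x. T n (fst x) (snd x)) \<in> borel_measurable ((\<Pi>\<^sub>M i\<in>I n. borel) \<Otimes>\<^sub>M borel)"
      using T by (simp add: regression_estimator_def case_prod_beta')
    have In: "i \<in> I n \<Longrightarrow> W i \<in> borel_measurable M" for i
      using split[OF n] W_measurable by auto
    have "train n \<in> measurable M (\<Pi>\<^sub>M i\<in>I n. borel)"
      unfolding train_def[abs_def] by (intro measurable_restrict In)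
    moreover have "Z i \<in> borel_measurable M" using XYZ_measurable split[OF n] i by auto
    ultimately have "(\<lambda>\<omega>. (train n \<omega>, Z i \<omega>)) \<in> measurable M ((\<Pi>\<^sub>M i\<in>I n. borel) \<Otimes>\<^sub>M borel)"
      by (rule measurable_Pair)
    from measurable_compose[OF this Tm] show ?thesis
      by (simp add: fitted_def train_def)
  qed
  have [measurable]: "X i \<in> borel_measurable M" "Y i \<in> borel_measurable M" if "i \<in> J n" for i
    using XYZ_measurable split[OF n] that by auto
  note [measurable] = fit[of Tx, OF Tx] fit[of Ty, OF Ty]
  show ?thesis unfolding residual_corr_def by measurable
qed

end

section \<open>Asymptotic normality of the cross-fitted correlation\<close>

context ganm_sample
begin

lemma influence_clt:
  "weak_conv_m (\<lambda>n. distr M borel (\<lambda>\<omega>. (\<Sum>i\<in>{1..n}. \<psi> (W i \<omega>)) / sqrt (real n) / (1 - \<rho>\<^sup>2)))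
     std_normal_distribution"
proof -
  have Wm: "W (Suc i) \<in> borel_measurable M" for i using W_measurable by auto
  have "indep_vars (\<lambda>_. borel) (\<lambda>i. W (Suc i)) UNIV"
    unfolding indep_vars_def2
  proof (intro conjI ballI Wm)
    let ?E = "\<lambda>i. {W i -` A \<inter> space M |A. A \<in> sets borel}"
    have "indep_sets ?E {1..}" using indep_W unfolding indep_vars_def2 by (rule conjunct2)
    then show "indep_sets (\<lambda>i. ?E (Suc i)) UNIV"
      by (rule indep_sets_reindex_Suc)
  qed
  then have ind: "indep_vars (\<lambda>_. borel) (\<lambda>i \<omega>. \<psi> (W (Suc i) \<omega>)) UNIV"
    by (rule indep_vars_compose2) measurable
  have mom: "expectation (\<lambda>\<omega>. \<psi> (W (Suc i) \<omega>)) = 0"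
    "integrable M (\<lambda>\<omega>. (\<psi> (W (Suc i) \<omega>))\<^sup>2)" "expectation (\<lambda>\<omega>. (\<psi> (W (Suc i) \<omega>))\<^sup>2) = (1 - \<rho>\<^sup>2)\<^sup>2" for i
    using influence_moments[of "Suc i"] by (simp_all add: has_bochner_integral_iff)
  have law: "distr M borel (\<lambda>\<omega>. \<psi> (W (Suc i) \<omega>)) = distr (distr M borel (W 1)) borel \<psi>" for i
  proof -
    have "distr M borel (\<lambda>\<omega>. \<psi> (W (Suc i) \<omega>)) = distr (distr M borel (W (Suc i))) borel \<psi>"
      by (subst distr_distr[OF _ Wm]) (auto simp: comp_def)
    then show ?thesis using ident_W[of "Suc i"] by simp
  qed
  have "weak_conv_m (\<lambda>n. distr M borel (\<lambda>\<omega>. (\<Sum>i<n. \<psi> (W (Suc i) \<omega>)) / sqrt (n * (1 - \<rho>\<^sup>2)\<^sup>2)))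
      std_normal_distribution"
    by (rule central_limit_theorem_zero_mean[OF ind mom(1) parameters(5) mom(2) _ law])
      (simp add: mom)
  moreover have "(\<Sum>i<n. \<psi> (W (Suc i) \<omega>)) / sqrt (n * (1 - \<rho>\<^sup>2)\<^sup>2) =
      (\<Sum>i\<in>{1..n}. \<psi> (W i \<omega>)) / sqrt (real n) / (1 - \<rho>\<^sup>2)" for n \<omega>
  proof -
    have "(\<Sum>i<n. \<psi> (W (Suc i) \<omega>)) = (\<Sum>i\<in>{1..n}. \<psi> (W i \<omega>))"
      by (rule sum.reindex_bij_witness[of _ "\<lambda>i. i - 1" Suc]) auto
    then show ?thesis using parameters(5) by (simp add: real_sqrt_mult)
  qed
  ultimately show ?thesis by simp
qed

end

theorem theorem2:
  fixes M :: "'a measure"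
    and X Y :: "nat \<Rightarrow> 'a \<Rightarrow> real"
    and Z :: "nat \<Rightarrow> 'a \<Rightarrow> 'z :: euclidean_space"
    and W :: "nat \<Rightarrow> 'a \<Rightarrow> real \<times> real \<times> 'z"
    and PZ :: "'z measure"
    and fZ :: "'z \<Rightarrow> ennreal"
    and mx my :: "'z \<Rightarrow> real"
    and \<sigma>x \<sigma>y \<rho> :: real
    and Tx1 Ty1 Tx2 Ty2 :: "nat \<Rightarrow> (nat \<Rightarrow> real \<times> real \<times> 'z) \<Rightarrow> 'z \<Rightarrow> real"
    and mhx1 mhy1 mhx2 mhy2 :: "nat \<Rightarrow> 'a \<Rightarrow> 'z \<Rightarrow> real"
    and rate :: "nat \<Rightarrow> real"
    and \<rho>hat :: "nat \<Rightarrow> 'a \<Rightarrow> real"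
  defines "W \<equiv> \<lambda>i \<omega>. (X i \<omega>, Y i \<omega>, Z i \<omega>)"
    and "PZ \<equiv> distr M borel (Z 1)"
    and "mhx1 \<equiv> \<lambda>n1. fitted W {1..n1} (Tx1 n1)"
    and "mhy1 \<equiv> \<lambda>n1. fitted W {1..n1} (Ty1 n1)"
    and "mhx2 \<equiv> \<lambda>n1. fitted W {n1 + 1..2 * n1} (Tx2 n1)"
    and "mhy2 \<equiv> \<lambda>n1. fitted W {n1 + 1..2 * n1} (Ty2 n1)"
    and "rate \<equiv> \<lambda>n1. real n1 powr (- 1 / 4)"
    and "\<rho>hat \<equiv> \<lambda>n1. cross_fit_corr X Y Z n1 (2 * n1) (mhx1 n1) (mhy1 n1) (mhx2 n1) (mhy2 n1)"
  assumes "prob_space M"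
    and "iid M borel {1..} W"
    and "\<And>i. i \<ge> 1 \<Longrightarrow> GANM M (X i) (Y i) (Z i) fZ mx my \<sigma>x \<sigma>y \<rho>"
    and "\<And>n1. n1 \<ge> 1 \<Longrightarrow> regression_estimator {1..n1} (Tx1 n1)"
    and "\<And>n1. n1 \<ge> 1 \<Longrightarrow> regression_estimator {1..n1} (Ty1 n1)"
    and "\<And>n1. n1 \<ge> 1 \<Longrightarrow> regression_estimator {n1 + 1..2 * n1} (Tx2 n1)"
    and "\<And>n1. n1 \<ge> 1 \<Longrightarrow> regression_estimator {n1 + 1..2 * n1} (Ty2 n1)"
    and "small_o_p M (\<lambda>n1 \<omega>. L2_norm PZ (\<lambda>z. mhx1 n1 \<omega> z - mx z)) rate"
    and "small_o_p M (\<lambda>n1 \<omega>. L2_norm PZ (\<lambda>z. mhy1 n1 \<omega> z - my z)) rate"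
    and "small_o_p M (\<lambda>n1 \<omega>. L2_norm PZ (\<lambda>z. mhx2 n1 \<omega> z - mx z)) rate"
    and "small_o_p M (\<lambda>n1 \<omega>. L2_norm PZ (\<lambda>z. mhy2 n1 \<omega> z - my z)) rate"
  shows "weak_conv_m
    (\<lambda>n1. distr M borel (\<lambda>\<omega>. sqrt (real (2 * n1)) * (\<rho>hat n1 \<omega> - \<rho>)))
    (density lborel (\<lambda>x. ennreal (normal_density 0 (1 - \<rho>\<^sup>2) x)))"
proof -
  interpret S: ganm_sample M X Y Z fZ mx my \<sigma>x \<sigma>y \<rho>
    using assms(9-11) unfolding W_def by (intro ganm_sample.intro ganm_sample_axioms.intro) auto
  interpret first: sample_split M X Y Z fZ mx my \<sigma>x \<sigma>y \<rho> "\<lambda>n. {1..n}" "\<lambda>n. {n + 1..2 * n}"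
    by unfold_locales auto
  interpret second: sample_split M X Y Z fZ mx my \<sigma>x \<sigma>y \<rho> "\<lambda>n. {n + 1..2 * n}" "\<lambda>n. {1..n}"
    by unfold_locales auto
  have W: "W = S.W" by (simp add: W_def S.W_def[abs_def])
  have PZ: "PZ = S.PZ" by (simp add: PZ_def S.PZ_def)
  note fits = mhx1_def mhy1_def mhx2_def mhy2_def
  let ?r1 = "\<lambda>n \<omega>. residual_corr {n + 1..2 * n} (\<lambda>i. X i \<omega> - mhx1 n \<omega> (Z i \<omega>)) (\<lambda>i. Y i \<omega> - mhy1 n \<omega> (Z i \<omega>))"
  let ?r2 = "\<lambda>n \<omega>. residual_corr {1..n} (\<lambda>i. X i \<omega> - mhx2 n \<omega> (Z i \<omega>)) (\<lambda>i. Y i \<omega> - mhy2 n \<omega> (Z i \<omega>))"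
  let ?\<psi> = "\<lambda>i \<omega>. S.\<psi> (S.W i \<omega>)"
  have e1: "((\<lambda>(n, \<omega>). sqrt (real n) * (?r1 n \<omega> - \<rho>) - (\<Sum>i\<in>{n + 1..2 * n}. ?\<psi> i \<omega>) / sqrt (real n)) \<longlongrightarrow> 0) (in_prob M)"
    using first.half_sample_expansion[of Tx1 Ty1, OF assms(12,13)] assms(16,17)
    unfolding fits rate_def W PZ by blast
  have e2: "((\<lambda>(n, \<omega>). sqrt (real n) * (?r2 n \<omega> - \<rho>) - (\<Sum>i\<in>{1..n}. ?\<psi> i \<omega>) / sqrt (real n)) \<longlongrightarrow> 0) (in_prob M)"
    using second.half_sample_expansion[of Tx2 Ty2, OF assms(14,15)] assms(18,19)
    unfolding fits rate_def W PZ by blast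
  \<comment> \<open>the statistic built from the unobservable errors, on the standard normal scale\<close>
  define U where "U n \<omega> = (\<Sum>i\<in>{1..2 * n}. ?\<psi> i \<omega>) / sqrt (real (2 * n)) / (1 - \<rho>\<^sup>2)" for n \<omega>
  define V where "V n \<omega> = sqrt (real (2 * n)) * (\<rho>hat n \<omega> - \<rho>)" for n \<omega>
  have \<rho>hat: "\<rho>hat n \<omega> = (?r2 n \<omega> + ?r1 n \<omega>) / 2" for n \<omega>
    by (simp add: \<rho>hat_def cross_fit_corr_def)
  have V_meas: "\<forall>\<^sub>F n in sequentially. V n \<in> borel_measurable M"
    using eventually_ge_at_top[of 1]
  proof eventually_elim
    case (elim n)
    have [measurable]: "?r1 n \<in> borel_measurable M" "?r2 n \<in> borel_measurable M"
      using first.residual_corr_measurable[of n Tx1 Ty1, OF elim assms(12,13)[OF elim]]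
        second.residual_corr_measurable[of n Tx2 Ty2, OF elim assms(14,15)[OF elim]]
      unfolding fits W by blast+
    show ?case unfolding V_def[abs_def] \<rho>hat by measurable
  qed
  have U_meas: "U n \<in> borel_measurable M" for n
  proof -
    have [measurable]: "S.W i \<in> borel_measurable M" if "i \<in> {1..2 * n}" for i
      using S.W_measurable that by auto
    show ?thesis unfolding U_def[abs_def] by measurable
  qed
  have U_conv: "weak_conv_m (\<lambda>n. distr M borel (U n)) std_normal_distribution"
    unfolding U_def[abs_def] by (rule weak_conv_m_subseq[OF S.influence_clt]) (simp add: strict_mono_def)
  have diff: "((\<lambda>(n, \<omega>). V n \<omega> / (1 - \<rho>\<^sup>2) - U n \<omega>) \<longlongrightarrow> 0) (in_prob M)"
  proof -
    have "V n \<omega> / (1 - \<rho>\<^sup>2) - U n \<omega> =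
        (sqrt (real n) * (?r1 n \<omega> - \<rho>) - (\<Sum>i\<in>{n + 1..2 * n}. ?\<psi> i \<omega>) / sqrt (real n) +
         (sqrt (real n) * (?r2 n \<omega> - \<rho>) - (\<Sum>i\<in>{1..n}. ?\<psi> i \<omega>) / sqrt (real n))) * (1 / (sqrt 2 * (1 - \<rho>\<^sup>2)))" for n \<omega>
    proof -
      have "{1..2 * n} = {1..n} \<union> {n + 1..2 * n}" by auto
      then have sums: "(\<Sum>i\<in>{1..2 * n}. ?\<psi> i \<omega>) = (\<Sum>i\<in>{1..n}. ?\<psi> i \<omega>) + (\<Sum>i\<in>{n + 1..2 * n}. ?\<psi> i \<omega>)"
        by (simp only:) (rule sum.union_disjoint, auto)
      have s2: "sqrt 2 / 2 = 1 / sqrt (2 :: real)" by (simp add: real_div_sqrt field_simps)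
      have "V n \<omega> = sqrt 2 / 2 * (sqrt (real n) * (?r1 n \<omega> - \<rho>) + sqrt (real n) * (?r2 n \<omega> - \<rho>))"
        unfolding V_def \<rho>hat by (simp add: real_sqrt_mult field_simps)
      then have V: "V n \<omega> = 1 / sqrt 2 * (sqrt (real n) * (?r1 n \<omega> - \<rho>) + sqrt (real n) * (?r2 n \<omega> - \<rho>))"
        unfolding s2 .
      have U: "U n \<omega> = 1 / sqrt 2 * ((\<Sum>i\<in>{1..n}. ?\<psi> i \<omega>) / sqrt (real n) +
          (\<Sum>i\<in>{n + 1..2 * n}. ?\<psi> i \<omega>) / sqrt (real n)) / (1 - \<rho>\<^sup>2)"
        unfolding U_def sums by (simp add: real_sqrt_mult add_divide_distrib mult_ac)
      show ?thesis
        unfolding U V by (simp add: algebra_simps diff_divide_distrib add_divide_distrib)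
    qed
    then show ?thesis
      using tendsto_mult_right_zero[OF tendsto_add_zero[OF e1 e2], of "1 / (sqrt 2 * (1 - \<rho>\<^sup>2))"]
        tendsto_mult_left_zero[OF tendsto_add_zero[OF e1 e2], of "1 / (sqrt 2 * (1 - \<rho>\<^sup>2))"]
      by (simp only: case_prod_beta')
  qed
  have "weak_conv_m (\<lambda>n. distr M borel (\<lambda>\<omega>. V n \<omega> / (1 - \<rho>\<^sup>2))) std_normal_distribution"
  proof (rule Slutsky_weak_conv[OF S.prob_space_axioms real_dist_normal_dist _ _ U_conv std_normal_no_atoms diff])
    show "\<forall>\<^sub>F n in sequentially. U n \<in> borel_measurable M" using U_meas by simp
    show "\<forall>\<^sub>F n in sequentially. (\<lambda>\<omega>. V n \<omega> / (1 - \<rho>\<^sup>2)) \<in> borel_measurable M"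
      using V_meas by eventually_elim (intro borel_measurable_divide borel_measurable_const)
  qed
  from weak_conv_std_normal_scale[OF S.parameters(5) V_meas this]
  show ?thesis unfolding V_def[abs_def] .
qed

end
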